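(* For every sequence $(X^{(n)})_{n\ge1}$ of transitive, reversible and irreducible continuous time Markov chains, with state spaces $S^{(n)}$, there is at least one nondegenerate sequence of Boolean functions $(f_n)_{n\ge1}$, $f_n\colon S^{(n)}\to\{0,1\}$, which is noise stable with respect to $(X^{(n)})_{n\ge1}$.
   Context: Each $X^{(n)}=(X^{(n)}_t)_{t\ge0}$ has a finite state space $S^{(n)}$ with $|S^{(n)}|\ge2$, generator $Q_n$ and stationary distribution $\pi_n$; $X_0^{(n)}$ is always distributed according to $\pi_n$. Let $\lambda_1^{(n)}>0$ be the smallest nonzero eigenvalue of $-Q_n$ (the spectral gap); the relaxation time is $t_{rel}^{(n)}=1/\lambda_1^{(n)}$. A Markov chain with state space $S$ and generator $Q=(q_{ij})_{i,j\in S}$ is transitive if for any $i,j\in S$ there is a bijection $\varphi\colon S\to S$ such that $\varphi(i)=j$ and $q_{\varphi(a)\varphi(b)}=q_{ab}$ for all $a,b\in S$. A sequence $(f_n)_{n\ge1}$ of Boolean functions $f_n\colon S^{(n)}\to\{0,1\}$ is nondegenerate if $\liminf_{n\to\infty}\operatorname{Var}(f_n)>0$, where $\operatorname{Var}(f_n)$ is the variance of $f_n(w)$ for $w\sim\pi_n$. It is noise stable with respect to $(X^{(n)})_{n\ge1}$ if $\lim_{\alpha\to0^+}\sup_n P\bigl(f_n(X_0^{(n)})\ne f_n(X^{(n)}_{\alpha t_{rel}^{(n)}})\bigr)=0$. *)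

theory Defs
  imports "HOL-Probability.Probability"
begin

text \<open>State spaces are finite sets \<open>S\<close> inside an arbitrary type, so that they may vary along a
  sequence. Matrices indexed by \<open>S\<close> are functions of two arguments, of which only the entries with
  both indices in \<open>S\<close> are relevant.\<close>

definition is_generator :: "'a set \<Rightarrow> ('a \<Rightarrow> 'a \<Rightarrow> real) \<Rightarrow> bool" where
  "is_generator S Q \<longleftrightarrow>
     (\<forall>i\<in>S. \<forall>j\<in>S. i \<noteq> j \<longrightarrow> 0 \<le> Q i j) \<and> (\<forall>i\<in>S. (\<Sum>j\<in>S. Q i j) = 0)"

primrec matrix_power :: "'a set \<Rightarrow> ('a \<Rightarrow> 'a \<Rightarrow> real) \<Rightarrow> nat \<Rightarrow> 'a \<Rightarrow> 'a \<Rightarrow> real" where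
  "matrix_power S Q 0 i j = of_bool (i = j)"
| "matrix_power S Q (Suc k) i j = (\<Sum>l\<in>S. Q i l * matrix_power S Q k l j)"

text \<open>The transition semigroup generated by \<open>Q\<close>, i.e. the matrix exponential of \<open>t Q\<close>.\<close>

definition transition_prob :: "'a set \<Rightarrow> ('a \<Rightarrow> 'a \<Rightarrow> real) \<Rightarrow> real \<Rightarrow> 'a \<Rightarrow> 'a \<Rightarrow> real" where
  "transition_prob S Q t i j = (\<Sum>k. t ^ k / fact k * matrix_power S Q k i j)"

text \<open>A continuous time Markov chain with finite state space \<open>S\<close>, generator \<open>Q\<close> and initial
  distribution \<open>\<mu>\<close>, specified by its finite-dimensional distributions; no regularity of the paths
  is required. Only times \<open>t \<ge> 0\<close> are meaningful.\<close>

locale ctmc = prob_space M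
  for M :: "'b measure" +
  fixes S :: "'a set" and Q :: "'a \<Rightarrow> 'a \<Rightarrow> real" and \<mu> :: "'a pmf" and X :: "real \<Rightarrow> 'b \<Rightarrow> 'a"
  assumes finite_states: "finite S"
    and generator: "is_generator S Q"
    and initial: "set_pmf \<mu> \<subseteq> S"
    and rv: "\<And>t. 0 \<le> t \<Longrightarrow> random_variable (count_space S) (X t)"
    and fdd: "\<And>(m::nat) (t::nat \<Rightarrow> real) (x::nat \<Rightarrow> 'a).
        t 0 = 0 \<Longrightarrow> (\<And>k. k < m \<Longrightarrow> t k \<le> t (Suc k)) \<Longrightarrow> (\<And>k. k \<le> m \<Longrightarrow> x k \<in> S) \<Longrightarrow>
        \<P>(\<omega> in M. \<forall>k\<le>m. X (t k) \<omega> = x k) =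
          pmf \<mu> (x 0) * (\<Prod>k<m. transition_prob S Q (t (Suc k) - t k) (x k) (x (Suc k)))"

definition stationary :: "'a set \<Rightarrow> ('a \<Rightarrow> 'a \<Rightarrow> real) \<Rightarrow> 'a pmf \<Rightarrow> bool" where
  "stationary S Q \<pi> \<longleftrightarrow> set_pmf \<pi> \<subseteq> S \<and> (\<forall>j\<in>S. (\<Sum>i\<in>S. pmf \<pi> i * Q i j) = 0)"

definition reversible :: "'a set \<Rightarrow> ('a \<Rightarrow> 'a \<Rightarrow> real) \<Rightarrow> 'a pmf \<Rightarrow> bool" where
  "reversible S Q \<pi> \<longleftrightarrow> (\<forall>i\<in>S. \<forall>j\<in>S. pmf \<pi> i * Q i j = pmf \<pi> j * Q j i)"

definition irreducible_generator :: "'a set \<Rightarrow> ('a \<Rightarrow> 'a \<Rightarrow> real) \<Rightarrow> bool" where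
  "irreducible_generator S Q \<longleftrightarrow>
     (\<forall>i\<in>S. \<forall>j\<in>S. (i, j) \<in> {(a, b). a \<in> S \<and> b \<in> S \<and> 0 < Q a b}\<^sup>*)"

definition transitive_generator :: "'a set \<Rightarrow> ('a \<Rightarrow> 'a \<Rightarrow> real) \<Rightarrow> bool" where
  "transitive_generator S Q \<longleftrightarrow>
     (\<forall>i\<in>S. \<forall>j\<in>S. \<exists>\<phi>. bij_betw \<phi> S S \<and> \<phi> i = j \<and> (\<forall>a\<in>S. \<forall>b\<in>S. Q (\<phi> a) (\<phi> b) = Q a b))"

text \<open>Real eigenvalues suffice below: for a reversible irreducible chain all eigenvalues of
  \<open>-Q\<close> are real (and nonnegative).\<close>

definition neg_generator_eigenvalue :: "'a set \<Rightarrow> ('a \<Rightarrow> 'a \<Rightarrow> real) \<Rightarrow> real \<Rightarrow> bool" where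
  "neg_generator_eigenvalue S Q l \<longleftrightarrow>
     (\<exists>v :: 'a \<Rightarrow> real. (\<exists>i\<in>S. v i \<noteq> 0) \<and> (\<forall>i\<in>S. (\<Sum>j\<in>S. - Q i j * v j) = l * v i))"

definition spectral_gap :: "'a set \<Rightarrow> ('a \<Rightarrow> 'a \<Rightarrow> real) \<Rightarrow> real" where
  "spectral_gap S Q = Min {l. neg_generator_eigenvalue S Q l \<and> l \<noteq> 0}"

definition relaxation_time :: "'a set \<Rightarrow> ('a \<Rightarrow> 'a \<Rightarrow> real) \<Rightarrow> real" where
  "relaxation_time S Q = 1 / spectral_gap S Q"

definition nondegenerate :: "(nat \<Rightarrow> 'a pmf) \<Rightarrow> (nat \<Rightarrow> 'a \<Rightarrow> real) \<Rightarrow> bool" where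
  "nondegenerate \<pi> f \<longleftrightarrow> 0 < liminf (\<lambda>n. ereal (measure_pmf.variance (\<pi> n) (f n)))"

text \<open>The supremum is taken over a set of probabilities, which is bounded.\<close>

definition noise_stable ::
  "(nat \<Rightarrow> 'b measure) \<Rightarrow> (nat \<Rightarrow> 'a set) \<Rightarrow> (nat \<Rightarrow> 'a \<Rightarrow> 'a \<Rightarrow> real) \<Rightarrow>
   (nat \<Rightarrow> real \<Rightarrow> 'b \<Rightarrow> 'a) \<Rightarrow> (nat \<Rightarrow> 'a \<Rightarrow> real) \<Rightarrow> bool" where
  "noise_stable M S Q X f \<longleftrightarrow>
     ((\<lambda>\<alpha>. SUP n. \<P>(\<omega> in M n. f n (X n 0 \<omega>) \<noteq> f n (X n (\<alpha> * relaxation_time (S n) (Q n)) \<omega>)))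
        \<longlongrightarrow> 0) (at_right 0)"

end

theory Submission
  imports Defs
begin

text \<open>
  The stable functions are thresholds of an eigenfunction for the spectral gap. If \<open>v\<close> is an
  eigenfunction of \<open>-Q\<close> for the gap with mean square \<open>1\<close> under the stationary law, then the
  mean square of \<open>v (X\<^sub>0) - v (X\<^sub>t)\<close> at time \<open>t = \<alpha> * t\<^sub>r\<^sub>e\<^sub>l\<close> is \<open>2 * (1 - exp (- \<alpha>)) \<le> 2 * \<alpha>\<close>, whatever the
  chain (\<open>displacement_eigenvector\<close>). A uniformly random threshold \<open>\<theta>\<close> separates \<open>v (X\<^sub>0)\<close> from
  \<open>v (X\<^sub>t)\<close> with probability of order \<open>\<surd>\<alpha>\<close>. Taking the times \<open>\<alpha> = (1/16)\<^sup>k\<close> and summing with weights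
  \<open>2\<^sup>k\<close> yields a single \<open>\<theta>\<close> that is good for all of them (\<open>exists_common_threshold\<close>), and the times
  in between are covered because, for a reversible chain, the probability that \<open>f (X\<^sub>0)\<close> and
  \<open>f (X\<^sub>t)\<close> differ is nondecreasing in \<open>t\<close> (\<open>displacement_mono\<close>).

  Nondegeneracy requires an eigenfunction that is not concentrated on a small set of states, and
  this is the contribution of transitivity. Start from any eigenfunction \<open>v\<^sub>0\<close> and form
  \<open>\<Sum> \<epsilon>\<^sub>\<phi> * (v\<^sub>0 \<circ> \<phi>)\<close> over all automorphisms \<open>\<phi>\<close> of the chain, with independent random signs
  \<open>\<epsilon>\<^sub>\<phi>\<close>. It is again an eigenfunction; its second moment at a state \<open>x\<close> does not depend on \<open>x\<close> since
  the automorphisms act transitively, and its fourth moment is at most three times the square of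
  the second by Khinchine's inequality. Therefore some choice of signs gives an eigenfunction whose
  \<open>L\<^sup>1\<close> norm is at least a quarter of its \<open>L\<^sup>2\<close> norm (\<open>exists_spread_eigenvector\<close>). Having mean \<open>0\<close>, it
  exceeds \<open>1/16\<close>, and falls below \<open>-1/16\<close>, with probability at least \<open>1/256\<close> each
  (\<open>mass_above_of_positive_part\<close>), so every threshold in between gives a variance bounded away from
  \<open>0\<close>. All constants are absolute, hence uniform along the sequence of chains.

  That the spectral gap is a positive eigenvalue at all is part of the proof: there are finitely
  many eigenvalues by Bessel's inequality, they are nonnegative, and the maximum of the Rayleigh
  quotient is a positive one (\<open>spectral_gap_eigenvalue\<close>).
\<close>

section \<open>The transition semigroup\<close>

lemma matrix_power_add:
  assumes "finite S" "i \<in> S" "j \<in> S"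
  shows "matrix_power S Q (m + k) i j = (\<Sum>l\<in>S. matrix_power S Q m i l * matrix_power S Q k l j)"
  using assms(2)
proof (induction m arbitrary: i)
  case 0
  have "(\<Sum>l\<in>S. of_bool (i = l) * matrix_power S Q k l j) =
      (\<Sum>l\<in>S. if i = l then matrix_power S Q k l j else 0)"
    by (intro sum.cong) auto
  then show ?case using 0 assms(1) by simp
next
  case (Suc m)
  have "matrix_power S Q (Suc m + k) i j =
      (\<Sum>h\<in>S. \<Sum>l\<in>S. Q i h * (matrix_power S Q m h l * matrix_power S Q k l j))"
    using Suc by (simp add: sum_distrib_left)
  also have "\<dots> = (\<Sum>l\<in>S. \<Sum>h\<in>S. Q i h * (matrix_power S Q m h l * matrix_power S Q k l j))"
    by (rule sum.swap)
  finally show ?case by (simp add: sum_distrib_right mult.assoc)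
qed

lemma matrix_power_1:
  assumes "finite S" "j \<in> S"
  shows "matrix_power S Q (Suc 0) i j = Q i j"
proof -
  have "(\<Sum>l\<in>S. Q i l * of_bool (l = j)) = (\<Sum>l\<in>S. if l = j then Q i l else 0)"
    by (intro sum.cong) auto
  then show ?thesis using assms by simp
qed

text \<open>Moving the weight \<open>p\<close> through a product of \<open>k\<close> factors reverses their order, so the induction has
  to split off the first factor on one side and the last factor on the other.\<close>

lemma matrix_power_detailed_balance:
  assumes S: "finite S" and rev: "\<And>i j. i \<in> S \<Longrightarrow> j \<in> S \<Longrightarrow> p i * Q i j = p j * Q j i"
    and "i \<in> S" "j \<in> S"
  shows "p i * matrix_power S Q k i j = p j * matrix_power S Q k j i"
  using assms(3,4)
proof (induction k arbitrary: i j)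
  case 0
  then show ?case by (auto simp: of_bool_def)
next
  case (Suc k)
  have "p i * matrix_power S Q (Suc k) i j = (\<Sum>l\<in>S. (p i * Q i l) * matrix_power S Q k l j)"
    by (simp add: sum_distrib_left mult.assoc)
  also have "\<dots> = (\<Sum>l\<in>S. Q l i * (p l * matrix_power S Q k l j))"
    using Suc.prems by (intro sum.cong) (auto simp: rev[of i] ac_simps)
  also have "\<dots> = (\<Sum>l\<in>S. p j * (matrix_power S Q k j l * matrix_power S Q (Suc 0) l i))"
    using Suc.prems by (intro sum.cong) (auto simp: Suc.IH[of _ j] matrix_power_1[OF S] ac_simps
      simp del: matrix_power.simps)
  also have "\<dots> = p j * matrix_power S Q (k + Suc 0) j i"
    using Suc.prems S by (simp only: matrix_power_add sum_distrib_left)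
  finally show ?case by simp
qed

lemma matrix_power_eigenvector:
  assumes S: "finite S" and eig: "\<And>i. i \<in> S \<Longrightarrow> (\<Sum>j\<in>S. Q i j * v j) = l * v i" and "i \<in> S"
  shows "(\<Sum>j\<in>S. matrix_power S Q k i j * v j) = l ^ k * v i"
  using assms(3)
proof (induction k arbitrary: i)
  case 0
  have "(\<Sum>j\<in>S. of_bool (i = j) * v j) = (\<Sum>j\<in>S. if i = j then v j else 0)"
    by (intro sum.cong) auto
  then show ?case using 0 S by simp
next
  case (Suc k)
  have "(\<Sum>j\<in>S. matrix_power S Q (Suc k) i j * v j) =
      (\<Sum>j\<in>S. \<Sum>h\<in>S. Q i h * (matrix_power S Q k h j * v j))"
    by (simp add: sum_distrib_right mult.assoc)
  also have "\<dots> = (\<Sum>h\<in>S. \<Sum>j\<in>S. Q i h * (matrix_power S Q k h j * v j))"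
    by (rule sum.swap)
  also have "\<dots> = (\<Sum>h\<in>S. l ^ k * (Q i h * v h))"
    by (intro sum.cong refl) (simp add: Suc.IH mult.left_commute flip: sum_distrib_left)
  also have "\<dots> = l ^ Suc k * v i"
    by (simp add: eig Suc.prems flip: sum_distrib_left)
  finally show ?case .
qed

lemma summable_transition_series:
  assumes S: "finite S" and "i \<in> S"
  shows "summable (\<lambda>k. norm (t ^ k / fact k * matrix_power S Q k i j))"
proof -
  define C where "C = (\<Sum>i\<in>S. \<Sum>j\<in>S. \<bar>Q i j\<bar>)"
  have C: "(\<Sum>l\<in>S. \<bar>Q i l\<bar>) \<le> C" if "i \<in> S" for i
    unfolding C_def using S that
    by (intro member_le_sum[where f = "\<lambda>i. \<Sum>l\<in>S. \<bar>Q i l\<bar>"]) (auto intro: sum_nonneg)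
  have C0: "0 \<le> C" by (simp add: C_def sum_nonneg)
  have bound: "\<bar>matrix_power S Q k i j\<bar> \<le> C ^ k" if "i \<in> S" for k i
    using that
  proof (induction k arbitrary: i)
    case (Suc k)
    have "\<bar>matrix_power S Q (Suc k) i j\<bar> \<le> (\<Sum>l\<in>S. \<bar>Q i l * matrix_power S Q k l j\<bar>)"
      by (simp add: sum_abs)
    also have "\<dots> \<le> (\<Sum>l\<in>S. \<bar>Q i l\<bar> * C ^ k)"
      by (intro sum_mono) (simp add: abs_mult mult_left_mono Suc.IH)
    also have "\<dots> \<le> C * C ^ k"
      unfolding sum_distrib_right[symmetric] using C[OF Suc.prems] C0 by (intro mult_right_mono) auto
    finally show ?case by simp
  qed (simp add: of_bool_def)
  show ?thesis
  proof (rule summable_comparison_test')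
    show "summable (\<lambda>k. (\<bar>t\<bar> * C) ^ k / fact k)"
      using summable_exp_generic[of "\<bar>t\<bar> * C"] by (simp add: field_simps)
    show "norm (norm (t ^ k / fact k * matrix_power S Q k i j)) \<le> (\<bar>t\<bar> * C) ^ k / fact k" for k
      using bound[OF assms(2), of k]
      by (simp add: abs_mult power_abs power_mult_distrib divide_right_mono mult_left_mono)
  qed
qed

lemma transition_prob_eigenvector:
  assumes S: "finite S" and eig: "\<And>i. i \<in> S \<Longrightarrow> (\<Sum>j\<in>S. Q i j * v j) = l * v i" and i: "i \<in> S"
  shows "(\<Sum>j\<in>S. transition_prob S Q t i j * v j) = exp (t * l) * v i"
proof -
  have sm: "summable (\<lambda>k. t ^ k / fact k * matrix_power S Q k i j)" for j
    by (rule summable_norm_cancel[OF summable_transition_series[OF S i]])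
  have "(\<Sum>j\<in>S. transition_prob S Q t i j * v j) =
      (\<Sum>j\<in>S. \<Sum>k. t ^ k / fact k * matrix_power S Q k i j * v j)"
    unfolding transition_prob_def by (intro sum.cong refl suminf_mult2 sm)
  also have "\<dots> = (\<Sum>k. \<Sum>j\<in>S. t ^ k / fact k * matrix_power S Q k i j * v j)"
    by (rule suminf_sum[symmetric]) (intro summable_mult2 sm)
  also have "\<dots> = (\<Sum>k. (t * l) ^ k /\<^sub>R fact k * v i)"
  proof (intro arg_cong[where f = suminf] ext)
    fix k
    have "(\<Sum>j\<in>S. t ^ k / fact k * matrix_power S Q k i j * v j) =
        t ^ k / fact k * (\<Sum>j\<in>S. matrix_power S Q k i j * v j)"
      by (simp add: sum_distrib_left mult.assoc)
    also have "\<dots> = t ^ k / fact k * (l ^ k * v i)"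
      by (subst matrix_power_eigenvector[OF S eig i]) auto
    finally show "(\<Sum>j\<in>S. t ^ k / fact k * matrix_power S Q k i j * v j) =
        (t * l) ^ k /\<^sub>R fact k * v i"
      by (simp add: power_mult_distrib divide_inverse ac_simps)
  qed
  also have "\<dots> = exp (t * l) * v i"
    unfolding exp_def by (rule suminf_mult2[symmetric]) (rule summable_exp_generic)
  finally show ?thesis .
qed

lemma transition_prob_detailed_balance:
  assumes S: "finite S" and rev: "\<And>i j. i \<in> S \<Longrightarrow> j \<in> S \<Longrightarrow> p i * Q i j = p j * Q j i"
    and i: "i \<in> S" and j: "j \<in> S"
  shows "p i * transition_prob S Q t i j = p j * transition_prob S Q t j i"
proof -
  have sm: "summable (\<lambda>k. t ^ k / fact k * matrix_power S Q k i j)" if "i \<in> S" for i j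
    by (rule summable_norm_cancel[OF summable_transition_series[OF S that]])
  have "p i * transition_prob S Q t i j = (\<Sum>k. p i * (t ^ k / fact k * matrix_power S Q k i j))"
    unfolding transition_prob_def by (intro suminf_mult[symmetric] sm i)
  also have "\<dots> = (\<Sum>k. p j * (t ^ k / fact k * matrix_power S Q k j i))"
    using matrix_power_detailed_balance[where p = p and Q = Q, OF S rev i j]
    by (intro arg_cong[where f = suminf] ext) (simp add: mult.left_commute)
  also have "\<dots> = p j * transition_prob S Q t j i"
    unfolding transition_prob_def by (intro suminf_mult sm j)
  finally show ?thesis .
qed

text \<open>The Chapman--Kolmogorov equation: each coefficient of the Cauchy product of the two exponential
  series collapses by the binomial theorem.\<close>

lemma transition_prob_add:
  assumes S: "finite S" and i: "i \<in> S" and j: "j \<in> S"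
  shows "transition_prob S Q (s + t) i j =
    (\<Sum>l\<in>S. transition_prob S Q s i l * transition_prob S Q t l j)"
proof -
  let ?a = "\<lambda>s k i j. s ^ k / fact k * matrix_power S Q k i j"
  have "(\<lambda>k. \<Sum>l\<in>S. \<Sum>m\<le>k. ?a s m i l * ?a t (k - m) l j) sums
      (\<Sum>l\<in>S. transition_prob S Q s i l * transition_prob S Q t l j)"
    unfolding transition_prob_def
    by (intro sums_sum Cauchy_product_sums summable_transition_series S i)
  moreover have "(\<Sum>l\<in>S. \<Sum>m\<le>k. ?a s m i l * ?a t (k - m) l j) = ?a (s + t) k i j" for k
  proof -
    have "(\<Sum>l\<in>S. \<Sum>m\<le>k. ?a s m i l * ?a t (k - m) l j) =
        (\<Sum>m\<le>k. \<Sum>l\<in>S. ?a s m i l * ?a t (k - m) l j)"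
      by (rule sum.swap)
    also have "\<dots> = (\<Sum>m\<le>k. (s ^ m / fact m * (t ^ (k - m) / fact (k - m))) *
        (\<Sum>l\<in>S. matrix_power S Q m i l * matrix_power S Q (k - m) l j))"
      by (simp add: sum_distrib_left ac_simps)
    also have "\<dots> = (\<Sum>m\<le>k. (s ^ m / fact m * (t ^ (k - m) / fact (k - m))) *
        matrix_power S Q k i j)"
      using matrix_power_add[OF S i j, of Q] by (intro sum.cong refl) (metis le_add_diff_inverse atMost_iff)
    also have "\<dots> = (\<Sum>m\<le>k. s ^ m /\<^sub>R fact m * (t ^ (k - m) /\<^sub>R fact (k - m))) *
        matrix_power S Q k i j"
      unfolding sum_distrib_right by (intro sum.cong refl) (simp add: divide_inverse ac_simps)
    also have "(\<Sum>m\<le>k. s ^ m /\<^sub>R fact m * (t ^ (k - m) /\<^sub>R fact (k - m))) = (s + t) ^ k /\<^sub>R fact k"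
      by (rule exp_series_add_commuting[symmetric]) (rule mult.commute)
    finally show ?thesis by (simp add: divide_inverse ac_simps)
  qed
  ultimately show ?thesis
    unfolding transition_prob_def by (simp add: sums_iff)
qed

text \<open>The weights \<open>p\<close> are positive so that they define an inner product on the functions on \<open>S\<close>;
  detailed balance says that \<open>Q\<close> is self-adjoint for it.\<close>

locale reversible_generator =
  fixes S :: "'a set" and Q :: "'a \<Rightarrow> 'a \<Rightarrow> real" and p :: "'a \<Rightarrow> real"
  assumes finite_S: "finite S"
    and generator: "is_generator S Q"
    and pos: "\<And>i. i \<in> S \<Longrightarrow> 0 < p i"
    and total: "(\<Sum>i\<in>S. p i) = 1"
    and detailed_balance: "\<And>i j. i \<in> S \<Longrightarrow> j \<in> S \<Longrightarrow> p i * Q i j = p j * Q j i"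
begin

abbreviation P :: "real \<Rightarrow> 'a \<Rightarrow> 'a \<Rightarrow> real" where
  "P \<equiv> transition_prob S Q"

text \<open>For the chain started from \<open>p\<close> this is the mean square of \<open>f (X\<^sub>0) - f (X\<^sub>t)\<close>; if \<open>f\<close> takes only the
  values \<open>0\<close> and \<open>1\<close>, it is the probability that they differ.\<close>

definition displacement :: "real \<Rightarrow> ('a \<Rightarrow> real) \<Rightarrow> real" where
  "displacement t f = (\<Sum>i\<in>S. \<Sum>j\<in>S. p i * P t i j * (f i - f j)\<^sup>2)"

lemma row_sum: "i \<in> S \<Longrightarrow> (\<Sum>j\<in>S. Q i j) = 0"
  and off_diagonal: "i \<in> S \<Longrightarrow> j \<in> S \<Longrightarrow> i \<noteq> j \<Longrightarrow> 0 \<le> Q i j"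
  using generator by (auto simp: is_generator_def)

lemma weight_nonneg: "i \<in> S \<Longrightarrow> 0 \<le> p i"
  using pos by (simp add: less_imp_le)

lemma transition_row_sum: "i \<in> S \<Longrightarrow> (\<Sum>j\<in>S. P t i j) = 1"
  using transition_prob_eigenvector[OF finite_S, of Q "\<lambda>_. 1" 0 i t] by (simp add: row_sum)

lemmas transition_balance = transition_prob_detailed_balance[OF finite_S detailed_balance]

lemma transition_stationary:
  assumes "j \<in> S"
  shows "(\<Sum>i\<in>S. p i * P t i j) = p j"
proof -
  have "(\<Sum>i\<in>S. p i * P t i j) = (\<Sum>i\<in>S. p j * P t j i)"
    using assms by (intro sum.cong refl transition_balance) auto
  then show ?thesis by (simp add: transition_row_sum assms flip: sum_distrib_left)
qed

lemma displacement_eq: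
  "displacement t f =
    2 * (\<Sum>i\<in>S. p i * (f i)\<^sup>2) - 2 * (\<Sum>i\<in>S. p i * f i * (\<Sum>j\<in>S. P t i j * f j))"
proof -
  have "displacement t f = (\<Sum>i\<in>S. \<Sum>j\<in>S. p i * (f i)\<^sup>2 * P t i j) +
      (\<Sum>i\<in>S. \<Sum>j\<in>S. (f j)\<^sup>2 * (p i * P t i j)) - 2 * (\<Sum>i\<in>S. \<Sum>j\<in>S. p i * f i * (P t i j * f j))"
    unfolding displacement_def sum_distrib_left sum.distrib[symmetric] sum_subtractf[symmetric]
    by (intro sum.cong refl) (simp add: power2_eq_square algebra_simps)
  also have "(\<Sum>i\<in>S. \<Sum>j\<in>S. p i * (f i)\<^sup>2 * P t i j) = (\<Sum>i\<in>S. p i * (f i)\<^sup>2)"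
    by (intro sum.cong refl) (simp add: transition_row_sum flip: sum_distrib_left)
  also have "(\<Sum>i\<in>S. \<Sum>j\<in>S. (f j)\<^sup>2 * (p i * P t i j)) = (\<Sum>j\<in>S. (f j)\<^sup>2 * (\<Sum>i\<in>S. p i * P t i j))"
    unfolding sum_distrib_left by (rule sum.swap)
  also have "\<dots> = (\<Sum>i\<in>S. p i * (f i)\<^sup>2)"
    by (intro sum.cong refl) (simp add: transition_stationary)
  finally show ?thesis by (simp add: sum_distrib_left)
qed

lemma displacement_eigenvector:
  assumes "\<And>i. i \<in> S \<Longrightarrow> (\<Sum>j\<in>S. Q i j * v j) = - l * v i"
  shows "displacement t v = 2 * (1 - exp (- (t * l))) * (\<Sum>i\<in>S. p i * (v i)\<^sup>2)"
proof -
  have "(\<Sum>i\<in>S. p i * v i * (\<Sum>j\<in>S. P t i j * v j)) = (\<Sum>i\<in>S. exp (- (t * l)) * (p i * (v i)\<^sup>2))"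
    using transition_prob_eigenvector[OF finite_S assms]
    by (intro sum.cong refl) (simp add: power2_eq_square)
  also have "\<dots> = exp (- (t * l)) * (\<Sum>i\<in>S. p i * (v i)\<^sup>2)"
    by (simp only: sum_distrib_left)
  finally show ?thesis
    by (simp add: displacement_eq algebra_simps)
qed

text \<open>By reversibility the correlation of \<open>f\<close> at time distance \<open>2 * u\<close> is the squared norm of \<open>P\<^sub>u f\<close>;
  this is what makes it monotone in time.\<close>

lemma displacement_half_time:
  "displacement (2 * u) f =
    2 * (\<Sum>i\<in>S. p i * (f i)\<^sup>2) - 2 * (\<Sum>l\<in>S. p l * (\<Sum>j\<in>S. P u l j * f j)\<^sup>2)"
proof -
  have double: "P (2 * u) i j = (\<Sum>l\<in>S. P u i l * P u l j)" if "i \<in> S" "j \<in> S" for i j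
    using transition_prob_add[OF finite_S that, of Q u u] by simp
  have "(\<Sum>i\<in>S. p i * f i * (\<Sum>j\<in>S. P (2 * u) i j * f j)) =
      (\<Sum>i\<in>S. f i * (\<Sum>j\<in>S. \<Sum>l\<in>S. (p i * P u i l) * P u l j * f j))"
    unfolding sum_distrib_left
    by (intro sum.cong refl) (simp add: double double[unfolded mult.commute[of 2 u]]
      sum_distrib_left sum_distrib_right ac_simps)
  also have "\<dots> = (\<Sum>i\<in>S. f i * (\<Sum>j\<in>S. \<Sum>l\<in>S. (p l * P u l i) * P u l j * f j))"
    by (intro sum.cong refl arg_cong[where f = "\<lambda>y. _ * y"] arg_cong[where f = "\<lambda>y. y * _ * _"]
      transition_balance)
  also have "\<dots> = (\<Sum>i\<in>S. \<Sum>l\<in>S. \<Sum>j\<in>S. p l * (P u l i * f i * (P u l j * f j)))"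
    unfolding sum_distrib_left by (subst sum.swap[where A = S and B = S]) (simp add: ac_simps)
  also have "\<dots> = (\<Sum>l\<in>S. \<Sum>i\<in>S. \<Sum>j\<in>S. p l * (P u l i * f i * (P u l j * f j)))"
    by (rule sum.swap)
  also have "\<dots> = (\<Sum>l\<in>S. p l * (\<Sum>j\<in>S. P u l j * f j)\<^sup>2)"
    unfolding power2_eq_square sum_product by (simp add: sum_distrib_left ac_simps)
  finally show ?thesis by (simp add: displacement_eq)
qed

text \<open>With \<open>s = 2 * u\<close> and \<open>t = 2 * (w + u)\<close>, the function \<open>P\<^sub>w (P\<^sub>u f)\<close> has at most the norm of \<open>P\<^sub>u f\<close>, as
  averaging over a stationary transition kernel is a contraction (Jensen). The monotonicity allows
  one to control all times by controlling a sequence of times that tends to \<open>0\<close>.\<close>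

lemma displacement_mono:
  assumes nonneg: "\<And>t i j. 0 \<le> t \<Longrightarrow> i \<in> S \<Longrightarrow> j \<in> S \<Longrightarrow> 0 \<le> P t i j"
    and "0 \<le> s" "s \<le> t"
  shows "displacement s f \<le> displacement t f"
proof -
  define u w where "u = s / 2" and "w = (t - s) / 2"
  define g where "g l = (\<Sum>j\<in>S. P u l j * f j)" for l
  have st: "s = 2 * u" "t = 2 * (w + u)" "0 \<le> w"
    using assms by (auto simp: u_def w_def field_simps)
  have jensen: "(\<Sum>l\<in>S. P w i l * g l)\<^sup>2 \<le> (\<Sum>l\<in>S. P w i l * (g l)\<^sup>2)" if i: "i \<in> S" for i
  proof -
    define m where "m = (\<Sum>l\<in>S. P w i l * g l)"
    have "0 \<le> (\<Sum>l\<in>S. P w i l * (g l - m)\<^sup>2)"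
      using nonneg[OF st(3) i] by (intro sum_nonneg) auto
    also have "\<dots> = (\<Sum>l\<in>S. P w i l * (g l)\<^sup>2) - 2 * m * (\<Sum>l\<in>S. P w i l * g l) +
        m\<^sup>2 * (\<Sum>l\<in>S. P w i l)"
      unfolding sum_distrib_left sum_subtractf[symmetric] sum.distrib[symmetric]
      by (intro sum.cong refl) (simp add: power2_eq_square algebra_simps)
    finally show ?thesis
      unfolding m_def[symmetric] by (simp add: transition_row_sum i power2_eq_square)
  qed
  have "(\<Sum>j\<in>S. P (w + u) i j * f j) = (\<Sum>l\<in>S. P w i l * g l)" if "i \<in> S" for i
  proof -
    have "(\<Sum>j\<in>S. P (w + u) i j * f j) = (\<Sum>j\<in>S. \<Sum>l\<in>S. P w i l * (P u l j * f j))"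
      by (intro sum.cong refl)
        (simp add: transition_prob_add[OF finite_S that] sum_distrib_right mult.assoc)
    also have "\<dots> = (\<Sum>l\<in>S. \<Sum>j\<in>S. P w i l * (P u l j * f j))" by (rule sum.swap)
    finally show ?thesis by (simp add: g_def sum_distrib_left)
  qed
  then have "(\<Sum>i\<in>S. p i * (\<Sum>j\<in>S. P (w + u) i j * f j)\<^sup>2) \<le> (\<Sum>i\<in>S. p i * (\<Sum>l\<in>S. P w i l * (g l)\<^sup>2))"
    by (intro sum_mono mult_left_mono) (auto simp: jensen weight_nonneg)
  also have "\<dots> = (\<Sum>l\<in>S. \<Sum>i\<in>S. (g l)\<^sup>2 * (p i * P w i l))"
    unfolding sum_distrib_left by (subst sum.swap) (simp add: ac_simps)
  also have "\<dots> = (\<Sum>l\<in>S. p l * (g l)\<^sup>2)"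
    by (simp add: transition_stationary mult.commute flip: sum_distrib_left)
  finally show ?thesis
    unfolding st displacement_half_time g_def by simp
qed

end

section \<open>The spectral gap\<close>

text \<open>If \<open>b\<close> were nonzero, the linear term would dominate for small \<open>s\<close> of the sign opposite to \<open>b\<close>;
  \<open>s = - b / (\<bar>c\<bar> + 1)\<close> is small enough.\<close>

lemma linear_coefficient_eq_0:
  fixes b c :: real
  assumes "\<And>s. 0 \<le> 2 * s * b + s\<^sup>2 * c"
  shows "b = 0"
proof -
  define r where "r = \<bar>c\<bar> + 1"
  have r: "0 < r" "c < r" by (auto simp: r_def)
  define s where "s = - b / r"
  have sr: "s * r = - b" using r by (simp add: s_def)
  have "0 \<le> (2 * s * b + s\<^sup>2 * c) * r\<^sup>2"
    using assms by (intro mult_nonneg_nonneg) auto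
  also have "\<dots> = 2 * (s * r) * b * r + (s * r)\<^sup>2 * c"
    by (simp add: power2_eq_square algebra_simps)
  also have "\<dots> = b\<^sup>2 * (c - 2 * r)"
    unfolding sr by (simp add: power2_eq_square algebra_simps)
  finally have "b\<^sup>2 \<le> 0"
    using r by (simp add: zero_le_mult_iff)
  then show ?thesis by simp
qed

context reversible_generator
begin

definition laplace :: "('a \<Rightarrow> real) \<Rightarrow> 'a \<Rightarrow> real" where
  "laplace v i = (\<Sum>j\<in>S. - Q i j * v j)"

definition weighted_inner :: "('a \<Rightarrow> real) \<Rightarrow> ('a \<Rightarrow> real) \<Rightarrow> real" where
  "weighted_inner f g = (\<Sum>i\<in>S. p i * f i * g i)"

lemma eigenvalue_iff:
  "neg_generator_eigenvalue S Q l \<longleftrightarrow> (\<exists>v. (\<exists>i\<in>S. v i \<noteq> 0) \<and> (\<forall>i\<in>S. laplace v i = l * v i))"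
  by (simp add: neg_generator_eigenvalue_def laplace_def)

lemma inner_commute: "weighted_inner f g = weighted_inner g f"
  by (simp add: weighted_inner_def ac_simps)

lemma inner_add_scale_left:
  "weighted_inner (\<lambda>i. f i + s * h i) g = weighted_inner f g + s * weighted_inner h g"
  by (simp add: weighted_inner_def algebra_simps sum.distrib sum_distrib_left)

lemma laplace_add_scale: "laplace (\<lambda>i. v i + s * w i) = (\<lambda>i. laplace v i + s * laplace w i)"
proof
  fix i
  show "laplace (\<lambda>i. v i + s * w i) i = laplace v i + s * laplace w i"
    unfolding laplace_def sum_distrib_left sum.distrib[symmetric]
    by (intro sum.cong refl) (simp add: algebra_simps)
qed

lemma inner_self_nonneg: "0 \<le> weighted_inner v v"
  unfolding weighted_inner_def by (intro sum_nonneg) (simp add: weight_nonneg mult.assoc)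

lemma inner_self_eq_0: "weighted_inner v v = 0 \<longleftrightarrow> (\<forall>i\<in>S. v i = 0)"
proof -
  have "weighted_inner v v = 0 \<longleftrightarrow> (\<forall>i\<in>S. p i * v i * v i = 0)"
    unfolding weighted_inner_def using finite_S
    by (intro sum_nonneg_eq_0_iff) (auto simp: weight_nonneg mult.assoc)
  then show ?thesis using pos by force
qed

lemma inner_self_pos: "i \<in> S \<Longrightarrow> v i \<noteq> 0 \<Longrightarrow> 0 < weighted_inner v v"
  using inner_self_nonneg[of v] inner_self_eq_0[of v] by force

lemma laplace_symmetric: "weighted_inner v (laplace w) = weighted_inner w (laplace v)"
proof -
  have "weighted_inner v (laplace w) = (\<Sum>i\<in>S. \<Sum>j\<in>S. - (p i * Q i j * v i * w j))"
    by (simp add: weighted_inner_def laplace_def sum_distrib_left ac_simps)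
  also have "\<dots> = (\<Sum>i\<in>S. \<Sum>j\<in>S. - (p j * Q j i * v i * w j))"
    by (intro sum.cong refl) (simp add: detailed_balance)
  also have "\<dots> = (\<Sum>j\<in>S. \<Sum>i\<in>S. - (p j * Q j i * v i * w j))"
    by (rule sum.swap)
  also have "\<dots> = weighted_inner w (laplace v)"
    by (simp add: weighted_inner_def laplace_def sum_distrib_left ac_simps)
  finally show ?thesis .
qed

text \<open>Twice this quadratic form is the Dirichlet form
  \<open>\<Sum> p i * Q i j * (v i - v j)\<^sup>2\<close>, in which the only negative entries of \<open>Q\<close>, those on the diagonal,
  have the factor \<open>0\<close>.\<close>

lemma laplace_nonneg: "0 \<le> weighted_inner v (laplace v)"
proof -
  have "(\<Sum>i\<in>S. \<Sum>j\<in>S. p i * Q i j * (v i - v j)\<^sup>2) = (\<Sum>i\<in>S. \<Sum>j\<in>S. p i * (v i)\<^sup>2 * Q i j) +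
      (\<Sum>i\<in>S. \<Sum>j\<in>S. (v j)\<^sup>2 * (p i * Q i j)) + 2 * (\<Sum>i\<in>S. \<Sum>j\<in>S. p i * v i * (- Q i j * v j))"
    unfolding sum_distrib_left sum.distrib[symmetric]
    by (intro sum.cong refl) (simp add: power2_eq_square algebra_simps)
  also have "(\<Sum>i\<in>S. \<Sum>j\<in>S. p i * (v i)\<^sup>2 * Q i j) = 0"
    by (simp add: row_sum flip: sum_distrib_left)
  also have "(\<Sum>i\<in>S. \<Sum>j\<in>S. (v j)\<^sup>2 * (p i * Q i j)) = (\<Sum>i\<in>S. \<Sum>j\<in>S. (v j)\<^sup>2 * (p j * Q j i))"
    by (intro sum.cong refl) (simp add: detailed_balance)
  also have "\<dots> = (\<Sum>j\<in>S. \<Sum>i\<in>S. (v j)\<^sup>2 * p j * Q j i)"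
    by (subst sum.swap) (simp add: mult.assoc)
  also have "\<dots> = 0"
    by (simp add: row_sum flip: sum_distrib_left)
  also have "(\<Sum>i\<in>S. \<Sum>j\<in>S. p i * v i * (- Q i j * v j)) = weighted_inner v (laplace v)"
    by (simp add: weighted_inner_def laplace_def sum_distrib_left)
  finally have eq: "2 * weighted_inner v (laplace v) = (\<Sum>i\<in>S. \<Sum>j\<in>S. p i * Q i j * (v i - v j)\<^sup>2)"
    by simp
  have "0 \<le> p i * Q i j * (v i - v j)\<^sup>2" if "i \<in> S" "j \<in> S" for i j
    using that off_diagonal[of i j] weight_nonneg[of i] by (cases "i = j") auto
  then have "0 \<le> 2 * weighted_inner v (laplace v)"
    unfolding eq by (intro sum_nonneg)
  then show ?thesis by simp
qed

lemma inner_laplace_eigenvector: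
  "\<forall>i\<in>S. laplace v i = l * v i \<Longrightarrow> weighted_inner w (laplace v) = l * weighted_inner w v"
  by (simp add: weighted_inner_def sum_distrib_left ac_simps)

lemma eigenvalue_nonneg:
  assumes "neg_generator_eigenvalue S Q l"
  shows "0 \<le> l"
proof -
  obtain v i where v: "i \<in> S" "v i \<noteq> 0" "\<forall>i\<in>S. laplace v i = l * v i"
    using assms by (auto simp: eigenvalue_iff)
  have "0 \<le> l * weighted_inner v v"
    using laplace_nonneg[of v] by (simp add: inner_laplace_eigenvector[OF v(3)])
  then show ?thesis using inner_self_pos[where v = v, OF v(1,2)] by (simp add: zero_le_mult_iff)
qed

text \<open>Normalised eigenvectors \<open>u l\<close> for distinct eigenvalues are orthonormal. Bessel's inequality for the
  normalised point mass at \<open>x\<close> gives \<open>\<Sum> p x * (u l x)\<^sup>2 \<le> 1\<close>, and summing this over \<open>x\<close> counts the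
  eigenvalues.\<close>

lemma card_eigenvalues_le:
  assumes L: "finite L" "\<And>l. l \<in> L \<Longrightarrow> neg_generator_eigenvalue S Q l"
  shows "card L \<le> card S"
proof -
  have "\<exists>u. weighted_inner u u = 1 \<and> (\<forall>i\<in>S. laplace u i = l * u i)" if l: "l \<in> L" for l
  proof -
    obtain v i where v: "i \<in> S" "v i \<noteq> 0" "\<forall>i\<in>S. laplace v i = l * v i"
      using L(2)[OF l] by (auto simp: eigenvalue_iff)
    define r where "r = sqrt (weighted_inner v v)"
    have r: "0 < r" "r\<^sup>2 = weighted_inner v v" using inner_self_pos[where v = v, OF v(1,2)] by (auto simp: r_def)
    have "weighted_inner (\<lambda>i. v i / r) (\<lambda>i. v i / r) = weighted_inner v v / r\<^sup>2"
      by (simp add: weighted_inner_def power2_eq_square sum_divide_distrib)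
    moreover have "laplace (\<lambda>i. v i / r) i = laplace v i / r" for i
      by (simp add: laplace_def sum_divide_distrib)
    ultimately show ?thesis using v r by (intro exI[of _ "\<lambda>i. v i / r"]) auto
  qed
  then obtain u where u: "\<And>l. l \<in> L \<Longrightarrow> weighted_inner (u l) (u l) = 1"
      "\<And>l. l \<in> L \<Longrightarrow> \<forall>i\<in>S. laplace (u l) i = l * u l i"
    by metis
  have orth: "weighted_inner (u l) (u m) = of_bool (l = m)" if "l \<in> L" "m \<in> L" for l m
  proof (cases "l = m")
    case False
    have "m * weighted_inner (u l) (u m) = l * weighted_inner (u l) (u m)"
      using laplace_symmetric[of "u l" "u m"] that
      by (simp add: inner_laplace_eigenvector[OF u(2)] inner_commute)
    then show ?thesis using False by simp
  qed (use u that in simp)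
  have bessel: "(\<Sum>l\<in>L. p x * (u l x)\<^sup>2) \<le> 1" if x: "x \<in> S" for x
  proof -
    \<comment> \<open>\<open>h\<close> is the projection of the function \<open>of_bool (i = x) / p x\<close> to the span of the \<open>u l\<close>; the
      nonnegative quantity below is the squared norm of the difference.\<close>
    define h where "h i = (\<Sum>l\<in>L. u l x * u l i)" for i
    define W where "W = (\<Sum>l\<in>L. (u l x)\<^sup>2)"
    have hh: "weighted_inner h h = W"
    proof -
      have "weighted_inner h h = (\<Sum>i\<in>S. \<Sum>l\<in>L. \<Sum>m\<in>L. u l x * u m x * (p i * u l i * u m i))"
        unfolding weighted_inner_def h_def mult.assoc sum_product by (simp add: sum_distrib_left ac_simps)
      also have "\<dots> = (\<Sum>l\<in>L. \<Sum>i\<in>S. \<Sum>m\<in>L. u l x * u m x * (p i * u l i * u m i))"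
        by (rule sum.swap)
      also have "\<dots> = (\<Sum>l\<in>L. \<Sum>m\<in>L. \<Sum>i\<in>S. u l x * u m x * (p i * u l i * u m i))"
        by (intro sum.cong refl sum.swap)
      also have "\<dots> = (\<Sum>l\<in>L. \<Sum>m\<in>L. u l x * u m x * weighted_inner (u l) (u m))"
        by (simp add: weighted_inner_def sum_distrib_left)
      also have "\<dots> = (\<Sum>l\<in>L. \<Sum>m\<in>L. if l = m then (u l x)\<^sup>2 else 0)"
        by (intro sum.cong refl) (auto simp: orth power2_eq_square)
      also have "\<dots> = W" using L(1) by (simp add: W_def)
      finally show ?thesis .
    qed
    have "0 \<le> p x * (1 / p x - h x)\<^sup>2 + (weighted_inner h h - p x * (h x)\<^sup>2)"
    proof (intro add_nonneg_nonneg)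
      have "p x * h x * h x \<le> weighted_inner h h"
        unfolding weighted_inner_def using finite_S x
        by (intro member_le_sum[where f = "\<lambda>i. p i * h i * h i"]) (auto simp: weight_nonneg mult.assoc)
      then show "0 \<le> weighted_inner h h - p x * (h x)\<^sup>2" by (simp add: power2_eq_square)
    qed (simp add: weight_nonneg x)
    also have "\<dots> = 1 / p x - W"
    proof -
      have "h x = W" by (simp add: h_def W_def power2_eq_square)
      then show ?thesis
        using pos[OF x] by (simp add: hh power2_eq_square field_simps)
    qed
    finally show ?thesis
      using pos[OF x] by (simp add: W_def field_simps flip: sum_distrib_left)
  qed
  have "real (card L) = (\<Sum>l\<in>L. weighted_inner (u l) (u l))" by (simp add: u)
  also have "\<dots> = (\<Sum>x\<in>S. \<Sum>l\<in>L. p x * (u l x)\<^sup>2)"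
    unfolding weighted_inner_def by (subst sum.swap) (simp add: power2_eq_square mult.assoc)
  also have "\<dots> \<le> (\<Sum>x\<in>S. 1)" by (intro sum_mono bessel)
  finally show ?thesis by simp
qed

lemma finite_eigenvalues: "finite {l. neg_generator_eigenvalue S Q l}"
proof (rule ccontr)
  assume "infinite {l. neg_generator_eigenvalue S Q l}"
  then obtain L where L: "finite L" "card L = Suc (card S)" "L \<subseteq> {l. neg_generator_eigenvalue S Q l}"
    using infinite_arbitrarily_large by blast
  then show False using card_eigenvalues_le[of L] by auto
qed

text \<open>The unit sphere of functions that vanish off \<open>S\<close> is compact by Tychonoff's theorem, because
  \<open>p i * (v i)\<^sup>2 \<le> 1\<close> confines each coordinate to an interval.\<close>

lemma exists_rayleigh_maximiser:
  assumes "S \<noteq> {}"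
  obtains v where "weighted_inner v v = 1" "\<And>w. weighted_inner w (laplace w) \<le> weighted_inner v (laplace v) * weighted_inner w w"
proof -
  define B where "B i = (if i \<in> S then {- (1 / sqrt (p i)) .. 1 / sqrt (p i)} else {0})" for i
  define K where "K = (\<Pi>\<^sub>E i\<in>UNIV. B i) \<inter> {v. weighted_inner v v = 1}"
  have cont_inner: "continuous_on UNIV (\<lambda>v. weighted_inner v v)"
    unfolding weighted_inner_def by (intro continuous_intros continuous_on_product_coordinates)
  have "compactin (product_topology (\<lambda>_. euclidean) UNIV) (\<Pi>\<^sub>E i\<in>UNIV. B i)"
    unfolding compactin_PiE by (auto simp: B_def)
  then have "compact (\<Pi>\<^sub>E i\<in>UNIV. B i)"
    by (simp add: euclidean_product_topology)
  then have "compact K"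
    unfolding K_def using cont_inner
    by (intro compact_Int_closed closed_Collect_eq continuous_on_const)
  have normalised: "(\<lambda>i. if i \<in> S then w i / sqrt (weighted_inner w w) else 0) \<in> K" if w: "weighted_inner w w \<noteq> 0" for w
  proof -
    define r where "r = sqrt (weighted_inner w w)"
    have r: "0 < r" "r\<^sup>2 = weighted_inner w w"
      using w inner_self_nonneg[of w] by (auto simp: r_def)
    let ?w = "\<lambda>i. if i \<in> S then w i / r else 0"
    have one: "weighted_inner ?w ?w = 1"
    proof -
      have "weighted_inner ?w ?w = weighted_inner w w / r\<^sup>2"
        by (simp add: weighted_inner_def power2_eq_square sum_divide_distrib)
      then show ?thesis using r w by simp
    qed
    have "?w i \<in> B i" for i
    proof (cases "i \<in> S")
      case True
      have "p i * ?w i * ?w i \<le> weighted_inner ?w ?w"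
        unfolding weighted_inner_def using finite_S True
        by (intro member_le_sum[where f = "\<lambda>i. p i * ?w i * ?w i"]) (auto simp: weight_nonneg mult.assoc)
      then have "(?w i)\<^sup>2 \<le> 1 / p i"
        using pos[OF True] one by (simp add: field_simps power2_eq_square)
      then have "\<bar>?w i\<bar> \<le> sqrt (1 / p i)"
        using real_le_rsqrt by (metis power2_abs)
      then have "\<bar>?w i\<bar> \<le> 1 / sqrt (p i)" by (simp add: real_sqrt_divide)
      then have "- (1 / sqrt (p i)) \<le> ?w i \<and> ?w i \<le> 1 / sqrt (p i)" by linarith
      then show ?thesis using True by (simp add: B_def)
    qed (simp add: B_def)
    then show ?thesis using one unfolding r_def[symmetric] by (simp add: K_def PiE_iff)
  qed
  have ne: "weighted_inner (\<lambda>_. 1) (\<lambda>_. 1) \<noteq> 0"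
    using assms by (auto simp: inner_self_eq_0)
  have "K \<noteq> {}" using normalised[OF ne] by blast
  moreover have "continuous_on K (\<lambda>v. weighted_inner v (laplace v))"
    unfolding weighted_inner_def laplace_def
    by (intro continuous_intros continuous_on_subset[OF continuous_on_product_coordinates]) auto
  ultimately obtain v where v: "v \<in> K" "\<And>w. w \<in> K \<Longrightarrow> weighted_inner w (laplace w) \<le> weighted_inner v (laplace v)"
    using continuous_attains_sup[OF \<open>compact K\<close>] by blast
  show ?thesis
  proof (rule that)
    show "weighted_inner v v = 1" using v(1) by (simp add: K_def)
    fix w
    show "weighted_inner w (laplace w) \<le> weighted_inner v (laplace v) * weighted_inner w w"
    proof (cases "weighted_inner w w = 0")
      case True
      then have "weighted_inner w (laplace w) = 0"
        by (simp add: inner_self_eq_0) (simp add: weighted_inner_def)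
      then show ?thesis using True by simp
    next
      case False
      define r where "r = sqrt (weighted_inner w w)"
      have r: "0 < r" "r\<^sup>2 = weighted_inner w w"
        using False inner_self_nonneg[of w] by (auto simp: r_def)
      let ?w = "\<lambda>i. if i \<in> S then w i / r else 0"
      have "laplace ?w i = laplace w i / r" for i
        by (simp add: laplace_def sum_divide_distrib cong: sum.cong)
      then have "weighted_inner ?w (laplace ?w) = weighted_inner w (laplace w) / r\<^sup>2"
        by (simp add: weighted_inner_def power2_eq_square sum_divide_distrib)
      moreover have "weighted_inner ?w (laplace ?w) \<le> weighted_inner v (laplace v)"
        using v(2)[OF normalised[OF False]] unfolding r_def .
      ultimately have "weighted_inner w (laplace w) / weighted_inner w w \<le> weighted_inner v (laplace v)"
        by (simp add: r(2))
      moreover have "0 < weighted_inner w w" using r by (metis zero_less_power)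
      ultimately show ?thesis by (simp add: pos_divide_le_eq)
    qed
  qed
qed

text \<open>The largest eigenvalue is the maximum of the Rayleigh quotient, and a maximiser satisfies the
  eigenvalue equation at \<open>k\<close> because the first variation in the direction of the point mass \<open>d k\<close>
  vanishes. The maximum is positive since the point mass at \<open>a\<close> has positive energy.\<close>

lemma exists_positive_eigenvalue:
  assumes "a \<in> S" "b \<in> S" "a \<noteq> b" "0 < Q a b"
  obtains l where "neg_generator_eigenvalue S Q l" "0 < l"
proof -
  obtain v where v: "weighted_inner v v = 1" "\<And>w. weighted_inner w (laplace w) \<le> weighted_inner v (laplace v) * weighted_inner w w"
    using exists_rayleigh_maximiser assms(1) by blast
  define m where "m = weighted_inner v (laplace v)"
  define d where "d k i = (of_bool (i = k) :: real)" for k i :: 'a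
  have inner_d: "weighted_inner (d k) g = p k * g k" if "k \<in> S" for k g
  proof -
    have "weighted_inner (d k) g = (\<Sum>i\<in>S. if i = k then p i * g i else 0)"
      unfolding weighted_inner_def by (intro sum.cong) (auto simp: d_def)
    then show ?thesis using that finite_S by simp
  qed
  have "laplace v k = m * v k" if k: "k \<in> S" for k
  proof -
    have "m * weighted_inner (d k) v - weighted_inner (d k) (laplace v) = 0"
    proof (rule linear_coefficient_eq_0)
      fix s
      let ?w = "\<lambda>i. v i + s * d k i"
      have "weighted_inner ?w (laplace ?w) = weighted_inner v (laplace v) + s * weighted_inner (d k) (laplace v) +
          s * (weighted_inner (d k) (laplace v) + s * weighted_inner (d k) (laplace (d k)))"
        unfolding laplace_add_scale inner_commute[of ?w] inner_add_scale_left
        by (simp add: inner_commute[of _ ?w] inner_commute[of "laplace _" ] inner_add_scale_left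
            laplace_symmetric[of v "d k"] algebra_simps)
      moreover have "weighted_inner ?w ?w = 1 + s * weighted_inner (d k) v + s * (weighted_inner (d k) v + s * weighted_inner (d k) (d k))"
        unfolding inner_add_scale_left inner_commute[of _ ?w]
        by (simp add: inner_add_scale_left v(1) inner_commute[of v "d k"])
      moreover have "weighted_inner ?w (laplace ?w) \<le> m * weighted_inner ?w ?w"
        unfolding m_def by (rule v(2))
      ultimately show "0 \<le> 2 * s * (m * weighted_inner (d k) v - weighted_inner (d k) (laplace v)) +
          s\<^sup>2 * (m * weighted_inner (d k) (d k) - weighted_inner (d k) (laplace (d k)))"
        by (simp add: m_def[symmetric] power2_eq_square algebra_simps)
    qed
    then show ?thesis using pos[OF k] by (simp add: inner_d k)
  qed
  moreover have "\<exists>i\<in>S. v i \<noteq> 0"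
    using v(1) inner_self_eq_0[of v] by auto
  ultimately have "neg_generator_eigenvalue S Q m"
    unfolding eigenvalue_iff by blast
  moreover have "0 < m"
  proof -
    have "Q a b \<le> (\<Sum>j\<in>S - {a}. Q a j)"
      using assms finite_S by (intro member_le_sum) (auto intro: off_diagonal)
    then have "Q a a < 0"
      using row_sum[OF assms(1)] assms finite_S by (simp add: sum.remove)
    moreover have "laplace (d a) a = - Q a a"
    proof -
      have "laplace (d a) a = (\<Sum>j\<in>S. if j = a then - Q a j else 0)"
        unfolding laplace_def by (intro sum.cong) (auto simp: d_def)
      then show ?thesis using assms finite_S by simp
    qed
    ultimately have "0 < weighted_inner (d a) (laplace (d a))"
      using pos[OF assms(1)] by (simp add: inner_d assms(1) mult_pos_neg)
    also have "\<dots> \<le> m * weighted_inner (d a) (d a)"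
      unfolding m_def by (rule v(2))
    finally show ?thesis using inner_self_nonneg[of "d a"] by (simp add: zero_less_mult_iff)
  qed
  ultimately show ?thesis using that by blast
qed

text \<open>The minimum that defines the gap is attained: there are only finitely many eigenvalues, and not
  all of them are zero.\<close>

lemma spectral_gap_eigenvalue:
  assumes "a \<in> S" "b \<in> S" "a \<noteq> b" "0 < Q a b"
  shows "neg_generator_eigenvalue S Q (spectral_gap S Q)" "0 < spectral_gap S Q"
proof -
  let ?L = "{l. neg_generator_eigenvalue S Q l \<and> l \<noteq> 0}"
  obtain l where "neg_generator_eigenvalue S Q l" "0 < l"
    using exists_positive_eigenvalue assms by blast
  moreover have "finite ?L"
    by (rule finite_subset[OF _ finite_eigenvalues]) auto
  ultimately have "spectral_gap S Q \<in> ?L"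
    unfolding spectral_gap_def by (intro Min_in) auto
  then show "neg_generator_eigenvalue S Q (spectral_gap S Q)" "0 < spectral_gap S Q"
    using eigenvalue_nonneg[of "spectral_gap S Q"] by auto
qed

end

section \<open>Random signs and the spread of an eigenfunction\<close>

text \<open>A subset \<open>A\<close> of \<open>G\<close> encodes a choice of signs on \<open>G\<close>, so that averages over \<open>Pow G\<close> are expectations
  over independent random signs.\<close>

definition signed_sum :: "'g set \<Rightarrow> 'g set \<Rightarrow> ('g \<Rightarrow> real) \<Rightarrow> real" where
  "signed_sum G A a = (\<Sum>g\<in>G. (if g \<in> A then 1 else -1) * a g)"

lemma signed_sum_mult_left: "signed_sum G A (\<lambda>g. l * a g) = l * signed_sum G A a"
  by (simp add: signed_sum_def sum_distrib_left ac_simps)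

lemma sum_Pow_signed_sum_insert:
  assumes "finite G" and "x \<notin> G"
  shows "(\<Sum>A\<in>Pow (insert x G). h (signed_sum (insert x G) A a)) =
    (\<Sum>A\<in>Pow G. h (signed_sum G A a - a x) + h (signed_sum G A a + a x))"
    (is "?L = ?R")
proof -
  have inj: "inj_on (insert x) (Pow G)"
    using assms(2) by (intro inj_onI) (metis PowD insert_ident subset_iff)
  have "?L = (\<Sum>A\<in>Pow G. h (signed_sum (insert x G) A a)) +
      (\<Sum>A\<in>insert x ` Pow G. h (signed_sum (insert x G) A a))"
    unfolding Pow_insert by (rule sum.union_disjoint) (use assms in auto)
  also have "(\<Sum>A\<in>insert x ` Pow G. h (signed_sum (insert x G) A a)) =
      (\<Sum>A\<in>Pow G. h (signed_sum (insert x G) (insert x A) a))"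
    using inj by (simp add: sum.reindex)
  also have "(\<Sum>A\<in>Pow G. h (signed_sum (insert x G) A a)) =
      (\<Sum>A\<in>Pow G. h (signed_sum G A a - a x))"
    using assms by (intro sum.cong) (auto simp: signed_sum_def)
  also have "(\<Sum>A\<in>Pow G. h (signed_sum (insert x G) (insert x A) a)) =
      (\<Sum>A\<in>Pow G. h (signed_sum G A a + a x))"
  proof (intro sum.cong refl)
    fix A assume "A \<in> Pow G"
    have "(\<Sum>g\<in>G. (if g \<in> insert x A then 1 else -1) * a g) =
        (\<Sum>g\<in>G. (if g \<in> A then 1 else -1) * a g)"
      by (intro sum.cong) (use assms(2) in auto)
    then show "h (signed_sum (insert x G) (insert x A) a) = h (signed_sum G A a + a x)"
      using assms by (simp add: signed_sum_def add.commute)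
  qed
  finally show ?thesis
    by (simp add: sum.distrib)
qed

lemma signed_sum_second_moment:
  assumes "finite G"
  shows "(\<Sum>A\<in>Pow G. (signed_sum G A a)\<^sup>2) = 2 ^ card G * (\<Sum>g\<in>G. (a g)\<^sup>2)"
  using assms
proof (induction G rule: finite_induct)
  case empty
  then show ?case by (simp add: signed_sum_def)
next
  case (insert x G)
  have eq: "(s - a x)\<^sup>2 + (s + a x)\<^sup>2 = 2 * s\<^sup>2 + 2 * (a x)\<^sup>2" for s
    by (simp add: power2_eq_square algebra_simps)
  have "(\<Sum>A\<in>Pow (insert x G). (signed_sum (insert x G) A a)\<^sup>2) =
      2 * (\<Sum>A\<in>Pow G. (signed_sum G A a)\<^sup>2) + 2 ^ card G * (2 * (a x)\<^sup>2)"
    using insert(1,2)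
    by (simp add: sum_Pow_signed_sum_insert[where h = "\<lambda>s. s\<^sup>2"] eq sum.distrib
        sum_distrib_left card_Pow)
  then show ?case
    using insert by (simp add: algebra_simps)
qed

text \<open>Khinchine's inequality for the exponent four, with its best constant.\<close>

lemma signed_sum_fourth_moment:
  assumes "finite G"
  shows "(\<Sum>A\<in>Pow G. (signed_sum G A a) ^ 4) \<le> 3 * 2 ^ card G * (\<Sum>g\<in>G. (a g)\<^sup>2)\<^sup>2"
  using assms
proof (induction G rule: finite_induct)
  case empty
  then show ?case by (simp add: signed_sum_def)
next
  case (insert x G)
  define V where "V = (\<Sum>g\<in>G. (a g)\<^sup>2)"
  have eq: "(s - a x) ^ 4 + (s + a x) ^ 4 = 2 * s ^ 4 + 12 * (a x)\<^sup>2 * s\<^sup>2 + 2 * (a x) ^ 4" for s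
    by (simp add: power2_eq_square power4_eq_xxxx algebra_simps)
  have "(\<Sum>A\<in>Pow (insert x G). (signed_sum (insert x G) A a) ^ 4) =
      2 * (\<Sum>A\<in>Pow G. (signed_sum G A a) ^ 4) +
      12 * (a x)\<^sup>2 * (\<Sum>A\<in>Pow G. (signed_sum G A a)\<^sup>2) + 2 ^ card G * (2 * (a x) ^ 4)"
    using insert(1,2)
    by (simp add: sum_Pow_signed_sum_insert[where h = "\<lambda>s. s ^ 4"] eq sum.distrib
        sum_distrib_left card_Pow)
  also have "\<dots> \<le> 2 * (3 * 2 ^ card G * V\<^sup>2) + 12 * (a x)\<^sup>2 * (2 ^ card G * V)
      + 2 ^ card G * (2 * (a x) ^ 4)"
    using insert(1,3) by (simp add: signed_sum_second_moment V_def)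
  also have "\<dots> \<le> 2 ^ card G * (6 * V\<^sup>2 + 12 * (a x)\<^sup>2 * V + 6 * (a x) ^ 4)"
    by (simp add: algebra_simps)
  also have "\<dots> = 3 * 2 ^ Suc (card G) * ((a x)\<^sup>2 + V)\<^sup>2"
    by (simp add: power2_eq_square power4_eq_xxxx algebra_simps)
  also have "\<dots> = 3 * 2 ^ card (insert x G) * (\<Sum>g\<in>insert x G. (a g)\<^sup>2)\<^sup>2"
    using insert(1,2) by (simp add: V_def)
  finally show ?case .
qed

text \<open>This pointwise bound turns a fourth moment bound into a lower bound for the first moment: a variable
  with second moment \<open>1\<close> and fourth moment at most \<open>3\<close> has first absolute moment at least \<open>1/4\<close>.\<close>

lemma abs_ge_quartic: "t\<^sup>2 - t ^ 4 / 4 \<le> \<bar>t\<bar>" for t :: real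
proof -
  define u where "u = \<bar>t\<bar>"
  have "0 \<le> u" by (simp add: u_def)
  \<comment> \<open>The minimum of \<open>u ^ 3 - 4 * u + 4\<close> on the positive axis is at \<open>2 / sqrt 3\<close>; the number \<open>6/5\<close> is a
    rational approximation of it that is good enough.\<close>
  have "0 \<le> (u - 6/5)\<^sup>2 * (u + 12/5)" using \<open>0 \<le> u\<close> by simp
  also have "\<dots> = u ^ 3 - 108/25 * u + 432/125"
    by (simp add: power2_eq_square power3_eq_cube field_simps)
  finally have "0 \<le> 1 - u + u ^ 3 / 4" using \<open>0 \<le> u\<close> by simp
  then have "0 \<le> u * (1 - u + u ^ 3 / 4)" using \<open>0 \<le> u\<close> by simp
  then have "u\<^sup>2 - u ^ 4 / 4 \<le> u"
    by (simp add: power2_eq_square power3_eq_cube power4_eq_xxxx algebra_simps)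
  then show ?thesis by (simp add: u_def)
qed

text \<open>For each \<open>x\<close> the random variable \<open>\<Sum> \<plusminus> u g x\<close> has second moment \<open>1\<close> and fourth moment at most \<open>3\<close>. Hence
  the random function has expected mean square \<open>1\<close> and expected mean absolute value at least \<open>1/4\<close>.
  Eight times the mean absolute value minus the mean square thus has expectation at least \<open>1\<close>, a value
  that some choice of signs reaches. Combining both norms in one linear expression makes a single
  choice control their ratio.\<close>

lemma exists_signs_large_L1:
  fixes p :: "'a \<Rightarrow> real" and u :: "'g \<Rightarrow> 'a \<Rightarrow> real"
  assumes S: "finite S" and G: "finite G"
    and p: "\<And>x. x \<in> S \<Longrightarrow> 0 \<le> p x" "(\<Sum>x\<in>S. p x) = 1"
    and u: "\<And>x. x \<in> S \<Longrightarrow> (\<Sum>g\<in>G. (u g x)\<^sup>2) = 1"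
  obtains A where "(\<Sum>x\<in>S. p x * (signed_sum G A (\<lambda>g. u g x))\<^sup>2) + 1
      \<le> 8 * (\<Sum>x\<in>S. p x * \<bar>signed_sum G A (\<lambda>g. u g x)\<bar>)"
proof -
  define N where "N = (2::real) ^ card G"
  define w where "w A x = signed_sum G A (\<lambda>g. u g x)" for A x
  define Z where "Z A = (\<Sum>x\<in>S. p x * (w A x)\<^sup>2)" for A
  define W where "W A = (\<Sum>x\<in>S. p x * \<bar>w A x\<bar>)" for A
  define F where "F A = (\<Sum>x\<in>S. p x * (w A x) ^ 4)" for A
  have Z: "(\<Sum>A\<in>Pow G. Z A) = N"
  proof -
    have "(\<Sum>A\<in>Pow G. Z A) = (\<Sum>x\<in>S. p x * (\<Sum>A\<in>Pow G. (w A x)\<^sup>2))"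
      unfolding Z_def sum_distrib_left by (rule sum.swap)
    also have "\<dots> = (\<Sum>x\<in>S. p x * N)"
      by (intro sum.cong) (auto simp: w_def signed_sum_second_moment[OF G] u N_def)
    finally show ?thesis using p(2) by (simp flip: sum_distrib_right)
  qed
  have F: "(\<Sum>A\<in>Pow G. F A) \<le> 3 * N"
  proof -
    have "(\<Sum>A\<in>Pow G. F A) = (\<Sum>x\<in>S. p x * (\<Sum>A\<in>Pow G. (w A x) ^ 4))"
      unfolding F_def sum_distrib_left by (rule sum.swap)
    also have "\<dots> \<le> (\<Sum>x\<in>S. p x * (3 * N))"
    proof (intro sum_mono mult_left_mono)
      fix x assume x: "x \<in> S"
      show "(\<Sum>A\<in>Pow G. (w A x) ^ 4) \<le> 3 * N"
        using signed_sum_fourth_moment[OF G, of "\<lambda>g. u g x"] by (simp add: w_def N_def u x)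
    qed (use p in auto)
    finally show ?thesis using p(2) by (simp flip: sum_distrib_right)
  qed
  have W: "Z A - F A / 4 \<le> W A" for A
  proof -
    have "Z A - F A / 4 = (\<Sum>x\<in>S. p x * ((w A x)\<^sup>2 - (w A x) ^ 4 / 4))"
      by (simp add: Z_def F_def right_diff_distrib sum_subtractf sum_divide_distrib)
    also have "\<dots> \<le> W A"
      unfolding W_def by (intro sum_mono mult_left_mono abs_ge_quartic) (use p in auto)
    finally show ?thesis .
  qed
  have "\<exists>A\<in>Pow G. Z A + 1 \<le> 8 * W A"
  proof (rule ccontr)
    assume neg: "\<not> ?thesis"
    then have "(\<Sum>A\<in>Pow G. 8 * (Z A - F A / 4)) < (\<Sum>A\<in>Pow G. Z A + 1)"
    proof (intro sum_strict_mono)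
      fix A assume A: "A \<in> Pow G"
      then have "8 * W A < Z A + 1" using neg by (simp add: not_le)
      moreover have "8 * (Z A - F A / 4) \<le> 8 * W A"
        using W[of A] by (rule mult_left_mono) simp
      ultimately show "8 * (Z A - F A / 4) < Z A + 1" by (rule le_less_trans[rotated])
    qed (use G in auto)
    also have "\<dots> = 2 * N"
      using G Z by (simp add: sum.distrib card_Pow N_def)
    also have "(\<Sum>A\<in>Pow G. 8 * (Z A - F A / 4)) = 8 * N - 2 * (\<Sum>A\<in>Pow G. F A)"
      using Z by (simp add: sum_subtractf right_diff_distrib flip: sum_distrib_left sum_divide_distrib)
    finally show False using F by simp
  qed
  then show ?thesis using that by (auto simp: Z_def W_def w_def)
qed

context reversible_generator
begin

definition automorphisms :: "('a \<Rightarrow> 'a) set" where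
  "automorphisms = {\<phi> \<in> S \<rightarrow>\<^sub>E S. bij_betw \<phi> S S \<and> (\<forall>a\<in>S. \<forall>b\<in>S. Q (\<phi> a) (\<phi> b) = Q a b)}"

lemma finite_automorphisms: "finite automorphisms"
  by (rule finite_subset[OF _ finite_PiE[of S "\<lambda>_. S"]]) (auto simp: automorphisms_def finite_S)

text \<open>An automorphism \<open>\<psi>\<close> that takes \<open>x\<close> to \<open>y\<close> permutes the automorphisms by composition. Functions are
  extensional on \<open>S\<close> so that there are only finitely many automorphisms and composition with \<open>\<psi>\<close> is
  injective on them.\<close>

lemma orbit_sum_const:
  assumes trans: "transitive_generator S Q" and xy: "x \<in> S" "y \<in> S"
  shows "(\<Sum>\<phi>\<in>automorphisms. h (\<phi> x)) = (\<Sum>\<phi>\<in>automorphisms. h (\<phi> y))"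
proof -
  obtain \<psi> where \<psi>: "bij_betw \<psi> S S" "\<psi> x = y" "\<forall>a\<in>S. \<forall>b\<in>S. Q (\<psi> a) (\<psi> b) = Q a b"
    using trans xy unfolding transitive_generator_def by blast
  have \<psi>S: "\<psi> a \<in> S" if "a \<in> S" for a using \<psi>(1) that by (auto simp: bij_betw_def)
  define C where "C \<phi> = restrict (\<phi> \<circ> \<psi>) S" for \<phi> :: "'a \<Rightarrow> 'a"
  have "C ` automorphisms \<subseteq> automorphisms"
  proof
    fix \<xi> assume "\<xi> \<in> C ` automorphisms"
    then obtain \<phi> where \<phi>: "\<phi> \<in> automorphisms" "\<xi> = C \<phi>" by blast
    have "bij_betw (\<phi> \<circ> \<psi>) S S"
      using \<phi>(1) \<psi>(1) by (auto simp: automorphisms_def intro: bij_betw_trans)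
    then have "bij_betw \<xi> S S"
      unfolding \<phi>(2) C_def by (simp add: bij_betw_restrict_eq)
    then show "\<xi> \<in> automorphisms"
      using \<phi> \<psi>S \<psi>(3) by (auto simp: automorphisms_def C_def)
  qed
  moreover have inj: "inj_on C automorphisms"
  proof
    fix \<phi> \<xi> assume A: "\<phi> \<in> automorphisms" "\<xi> \<in> automorphisms" "C \<phi> = C \<xi>"
    show "\<phi> = \<xi>"
    proof (rule extensionalityI[of _ S])
      fix a assume "a \<in> S"
      then obtain b where "b \<in> S" "a = \<psi> b" using \<psi>(1) by (auto simp: bij_betw_def)
      then show "\<phi> a = \<xi> a" using fun_cong[OF A(3), of b] by (simp add: C_def)
    qed (use A in \<open>auto simp: automorphisms_def PiE_iff\<close>)
  qed
  ultimately have img: "C ` automorphisms = automorphisms"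
    using finite_automorphisms by (intro endo_inj_surj)
  have "(\<Sum>\<phi>\<in>automorphisms. h (\<phi> x)) = (\<Sum>\<phi>\<in>C ` automorphisms. h (\<phi> x))"
    by (simp only: img)
  also have "\<dots> = (\<Sum>\<phi>\<in>automorphisms. h (C \<phi> x))"
    by (simp add: sum.reindex[OF inj])
  also have "\<dots> = (\<Sum>\<phi>\<in>automorphisms. h (\<phi> y))"
    using xy \<psi>(2) by (simp add: C_def)
  finally show ?thesis .
qed

lemma laplace_automorphism:
  assumes "\<phi> \<in> automorphisms" "i \<in> S"
  shows "laplace (\<lambda>x. v (\<phi> x)) i = laplace v (\<phi> i)"
proof -
  have bij: "bij_betw \<phi> S S" and inv: "\<And>j. j \<in> S \<Longrightarrow> Q i j = Q (\<phi> i) (\<phi> j)"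
    using assms by (auto simp: automorphisms_def)
  have "laplace (\<lambda>x. v (\<phi> x)) i = (\<Sum>j\<in>S. - Q (\<phi> i) (\<phi> j) * v (\<phi> j))"
    unfolding laplace_def by (intro sum.cong) (auto simp: inv)
  also have "\<dots> = laplace v (\<phi> i)"
    unfolding laplace_def by (rule sum.reindex_bij_betw[OF bij])
  finally show ?thesis .
qed

lemma laplace_signed_sum:
  "laplace (\<lambda>x. signed_sum G A (\<lambda>g. u g x)) i = signed_sum G A (\<lambda>g. laplace (u g) i)"
  unfolding laplace_def signed_sum_def sum_distrib_left
  by (subst sum.swap) (simp add: ac_simps)

lemma eigenvector_mean_zero:
  assumes "\<forall>i\<in>S. laplace v i = l * v i" "l \<noteq> 0"
  shows "(\<Sum>i\<in>S. p i * v i) = 0"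
proof -
  have "laplace (\<lambda>_. 1) i = 0" if "i \<in> S" for i
    by (simp add: laplace_def sum_negf row_sum that)
  then have "weighted_inner v (laplace (\<lambda>_. 1)) = 0"
    by (simp add: weighted_inner_def)
  then have "l * weighted_inner (\<lambda>_. 1) v = 0"
    using laplace_symmetric[of v "\<lambda>_. 1"] inner_laplace_eigenvector[OF assms(1), of "\<lambda>_. 1"] by simp
  then show ?thesis using assms(2) by (simp add: weighted_inner_def)
qed

text \<open>This is where transitivity is needed: a given eigenvector \<open>v0\<close> may be concentrated on a few states,
  and then every threshold of it has small variance. All translates \<open>v0 \<circ> \<phi>\<close> by automorphisms are
  eigenvectors, and the sum of their squares is constant on \<open>S\<close>, so a suitable signed sum of the
  translates has comparable \<open>L\<^sup>1\<close> and \<open>L\<^sup>2\<close> norms.\<close>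

lemma exists_spread_eigenvector:
  assumes trans: "transitive_generator S Q"
    and l: "neg_generator_eigenvalue S Q l" "l \<noteq> 0"
  obtains v where "\<forall>i\<in>S. laplace v i = l * v i" "(\<Sum>i\<in>S. p i * v i) = 0"
    "(\<Sum>i\<in>S. p i * (v i)\<^sup>2) = 1" "1/4 \<le> (\<Sum>i\<in>S. p i * \<bar>v i\<bar>)"
proof -
  let ?G = automorphisms
  obtain v0 x0 where v0: "x0 \<in> S" "v0 x0 \<noteq> 0" "\<forall>i\<in>S. laplace v0 i = l * v0 i"
    using l(1) by (auto simp: eigenvalue_iff)
  define c where "c = (\<Sum>\<phi>\<in>?G. (v0 (\<phi> x0))\<^sup>2)"
  have "restrict id S \<in> ?G"
    using bij_betw_id[of S] by (auto simp: automorphisms_def bij_betw_restrict_eq)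
  then have "(v0 (restrict id S x0))\<^sup>2 \<le> c"
    unfolding c_def using finite_automorphisms
    by (intro member_le_sum[where f = "\<lambda>\<phi>. (v0 (\<phi> x0))\<^sup>2"] zero_le_power2)
  then have "(v0 x0)\<^sup>2 \<le> c" using v0(1) by simp
  moreover have "0 < (v0 x0)\<^sup>2" using v0(2) by simp
  ultimately have c: "0 < c" by (rule less_le_trans[rotated])
  define u where "u \<phi> x = v0 (\<phi> x) / sqrt c" for \<phi> :: "'a \<Rightarrow> 'a" and x
  have u2: "(\<Sum>\<phi>\<in>?G. (u \<phi> x)\<^sup>2) = 1" if "x \<in> S" for x
  proof -
    have "(\<Sum>\<phi>\<in>?G. (u \<phi> x)\<^sup>2) = (\<Sum>\<phi>\<in>?G. (v0 (\<phi> x))\<^sup>2) / c"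
      using c by (simp add: u_def power_divide sum_divide_distrib)
    also have "(\<Sum>\<phi>\<in>?G. (v0 (\<phi> x))\<^sup>2) = c"
      unfolding c_def by (rule orbit_sum_const[OF trans that v0(1)])
    finally show ?thesis using c by simp
  qed
  obtain A where A: "(\<Sum>x\<in>S. p x * (signed_sum ?G A (\<lambda>\<phi>. u \<phi> x))\<^sup>2) + 1
      \<le> 8 * (\<Sum>x\<in>S. p x * \<bar>signed_sum ?G A (\<lambda>\<phi>. u \<phi> x)\<bar>)"
    by (rule exists_signs_large_L1[where u = u, OF finite_S finite_automorphisms weight_nonneg total u2])
  define w where "w x = signed_sum ?G A (\<lambda>\<phi>. u \<phi> x)" for x
  define Z where "Z = (\<Sum>x\<in>S. p x * (w x)\<^sup>2)"
  define W where "W = (\<Sum>x\<in>S. p x * \<bar>w x\<bar>)"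
  have ZW: "Z + 1 \<le> 8 * W" using A by (simp add: Z_def W_def w_def)
  have "0 \<le> Z" unfolding Z_def by (intro sum_nonneg) (simp add: weight_nonneg)
  have "\<exists>x\<in>S. w x \<noteq> 0"
  proof (rule ccontr)
    assume "\<not> ?thesis"
    then have "W = 0" by (simp add: W_def)
    then show False using ZW \<open>0 \<le> Z\<close> by simp
  qed
  then have "0 < weighted_inner w w" using inner_self_pos[where v = w] by blast
  then have Z: "0 < Z" by (simp add: Z_def weighted_inner_def power2_eq_square mult.assoc)
  define v where "v x = w x / sqrt Z" for x
  have "laplace w i = l * w i" if i: "i \<in> S" for i
  proof -
    have "laplace (u \<phi>) i = l * u \<phi> i" if \<phi>: "\<phi> \<in> ?G" for \<phi>
    proof -
      have "\<phi> i \<in> S" using \<phi> i by (auto simp: automorphisms_def)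
      moreover have "laplace (u \<phi>) i = laplace (\<lambda>x. v0 (\<phi> x)) i / sqrt c"
        by (simp add: laplace_def u_def sum_divide_distrib)
      ultimately show ?thesis using v0(3) by (simp add: laplace_automorphism[OF \<phi> i] u_def)
    qed
    then have "signed_sum ?G A (\<lambda>\<phi>. laplace (u \<phi>) i) = signed_sum ?G A (\<lambda>\<phi>. l * u \<phi> i)"
      by (simp add: signed_sum_def)
    then show ?thesis
      unfolding w_def laplace_signed_sum signed_sum_mult_left .
  qed
  moreover have "laplace v i = laplace w i / sqrt Z" for i
    by (simp add: laplace_def v_def sum_divide_distrib)
  ultimately have eig: "\<forall>i\<in>S. laplace v i = l * v i"
    by (simp add: v_def)
  show ?thesis
  proof (rule that[OF eig eigenvector_mean_zero[OF eig l(2)]])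
    show "(\<Sum>i\<in>S. p i * (v i)\<^sup>2) = 1"
      using Z by (simp add: v_def power_divide Z_def[symmetric] flip: sum_divide_distrib)
    have "2 * sqrt Z \<le> Z + 1"
      using zero_le_power2[of "sqrt Z - 1"] Z by (simp add: power2_eq_square algebra_simps)
    then have "sqrt Z / 4 \<le> W" using ZW by simp
    moreover have "(\<Sum>i\<in>S. p i * \<bar>v i\<bar>) = W / sqrt Z"
      using Z by (simp add: v_def W_def sum_divide_distrib)
    ultimately show "1/4 \<le> (\<Sum>i\<in>S. p i * \<bar>v i\<bar>)"
      using Z by (simp add: pos_le_divide_eq)
  qed
qed

end

section \<open>Thresholds\<close>

text \<open>As the mean is \<open>0\<close>, the positive part of \<open>v\<close> has mean at least \<open>1/8\<close>, and the part of it below \<open>1/16\<close>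
  accounts for at most half of this. The second moment prevents the rest from sitting on a tiny
  set.\<close>

lemma mass_above_of_positive_part:
  fixes p v :: "'a \<Rightarrow> real"
  assumes S: "finite S"
    and p: "\<And>x. x \<in> S \<Longrightarrow> 0 \<le> p x" "(\<Sum>x\<in>S. p x) = 1"
    and v0: "(\<Sum>x\<in>S. p x * v x) = 0" and v2: "(\<Sum>x\<in>S. p x * (v x)\<^sup>2) = 1"
    and v1: "1/4 \<le> (\<Sum>x\<in>S. p x * \<bar>v x\<bar>)"
  shows "1/256 \<le> (\<Sum>x\<in>{x\<in>S. 1/16 < v x}. p x)"
proof -
  \<comment> \<open>The coefficient of \<open>t\<^sup>2\<close> is chosen so that \<open>1/16 + 1/32\<close>, the mean of the first two terms, stays
    below \<open>1/8\<close>; the remaining \<open>1/32\<close> is \<open>8\<close> times the mass sought.\<close>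
  have pw: "(\<bar>t\<bar> + t) / 2 \<le> 1/16 + (t\<^sup>2 / 32 + 8 * of_bool (1/16 < t))" for t :: real
  proof -
    have "0 \<le> (t - 16)\<^sup>2" by simp
    then have "t \<le> t\<^sup>2 / 32 + 8" by (simp add: power2_eq_square algebra_simps)
    moreover have "0 \<le> t\<^sup>2" by simp
    moreover have "(\<bar>t\<bar> + t) / 2 \<le> 1/16" if "\<not> 1/16 < t" using that by (simp add: abs_if)
    ultimately show ?thesis by (cases "1/16 < t") (simp, smt (verit) divide_nonneg_nonneg of_bool_eq(1))
  qed
  have "1/8 \<le> (\<Sum>x\<in>S. p x * ((\<bar>v x\<bar> + v x) / 2))"
    using v1 v0 by (simp add: sum.distrib add_divide_distrib distrib_left flip: sum_divide_distrib)
  also have "\<dots> \<le> (\<Sum>x\<in>S. p x * (1/16 + ((v x)\<^sup>2 / 32 + 8 * of_bool (1/16 < v x))))"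
    by (intro sum_mono mult_left_mono pw) (use p in auto)
  also have "\<dots> = 1/16 + 1/32 + 8 * (\<Sum>x\<in>S. p x * of_bool (1/16 < v x))"
    using v2 p(2)
    by (simp add: distrib_left sum.distrib sum_distrib_left mult.left_commute
      flip: sum_divide_distrib)
  also have "(\<Sum>x\<in>S. p x * of_bool (1/16 < v x)) = (\<Sum>x\<in>{x\<in>S. 1/16 < v x}. p x)"
    using S by (intro sum.mono_neutral_cong_right) auto
  finally show ?thesis by simp
qed

text \<open>A uniformly random threshold \<open>\<theta>\<close> separates \<open>v i\<close> from \<open>v j\<close> with probability at most
  \<open>\<bar>v i - v j\<bar> / (b - a)\<close>. Since the weighted sum over all \<open>k\<close> is integrable in \<open>\<theta>\<close>, one threshold serves
  all \<open>k\<close> simultaneously. The slack between \<open>T\<close> and \<open>T'\<close> makes the contradiction strict.\<close>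

lemma exists_common_threshold:
  fixes v :: "'a \<Rightarrow> real" and w :: "nat \<Rightarrow> 'a \<Rightarrow> 'a \<Rightarrow> real" and c d :: "nat \<Rightarrow> real"
  assumes ab: "a < b"
    and w: "\<And>k i j. i \<in> S \<Longrightarrow> j \<in> S \<Longrightarrow> 0 \<le> w k i j"
    and c: "\<And>k. 0 \<le> c k"
    and d: "\<And>k. (\<Sum>i\<in>S. \<Sum>j\<in>S. w k i j * \<bar>v i - v j\<bar>) \<le> d k"
    and T: "\<And>n. (\<Sum>k<n. c k * d k) \<le> T" "T < T'"
  obtains \<theta> where "a \<le> \<theta>" "\<theta> \<le> b"
    "\<And>k. c k * (\<Sum>i\<in>S. \<Sum>j\<in>S. w k i j * of_bool ((\<theta> < v i) \<noteq> (\<theta> < v j))) \<le> T' / (b - a)"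
proof -
  have ennreal_sum2: "(\<Sum>i\<in>S. \<Sum>j\<in>S. ennreal (x i j)) = ennreal (\<Sum>i\<in>S. \<Sum>j\<in>S. x i j)"
    if "\<And>i j. i \<in> S \<Longrightarrow> j \<in> S \<Longrightarrow> 0 \<le> x i j" for x
    using that by (simp add: sum_ennreal sum_nonneg)
  define I where "I i j = {min (v i) (v j)..<max (v i) (v j)}" for i j
  define D where "D k \<theta> = (\<Sum>i\<in>S. \<Sum>j\<in>S. ennreal (c k * w k i j) * indicator (I i j) \<theta>)" for k \<theta>
  have D: "D k \<theta> = ennreal (c k * (\<Sum>i\<in>S. \<Sum>j\<in>S. w k i j * of_bool ((\<theta> < v i) \<noteq> (\<theta> < v j))))"
    for k \<theta>
  proof -
    have "D k \<theta> = (\<Sum>i\<in>S. \<Sum>j\<in>S. ennreal (c k * w k i j * of_bool ((\<theta> < v i) \<noteq> (\<theta> < v j))))"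
      unfolding D_def by (intro sum.cong refl) (auto simp: I_def of_bool_def indicator_def)
    also have "\<dots> = ennreal (\<Sum>i\<in>S. \<Sum>j\<in>S. c k * w k i j * of_bool ((\<theta> < v i) \<noteq> (\<theta> < v j)))"
      by (intro ennreal_sum2 mult_nonneg_nonneg) (auto intro: w c)
    finally show ?thesis by (simp add: sum_distrib_left mult.assoc)
  qed
  have T0: "0 \<le> T" using T(1)[of 0] by simp
  have I_meas [measurable]: "I i j \<in> sets borel" for i j
    by (simp add: I_def)
  have D_meas [measurable]: "D k \<in> borel_measurable borel" for k
    unfolding D_def by measurable
  have I_len: "emeasure lborel (I i j) = ennreal \<bar>v i - v j\<bar>" for i j
    by (auto simp: I_def min_def max_def)
  have int_D: "(\<integral>\<^sup>+\<theta>. D k \<theta> \<partial>lborel) \<le> ennreal (c k * d k)" for k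
  proof -
    have "(\<integral>\<^sup>+\<theta>. D k \<theta> \<partial>lborel) = (\<Sum>i\<in>S. \<Sum>j\<in>S. ennreal (c k * w k i j) * ennreal \<bar>v i - v j\<bar>)"
      unfolding D_def by (simp add: nn_integral_sum nn_integral_cmult I_len)
    also have "\<dots> = (\<Sum>i\<in>S. \<Sum>j\<in>S. ennreal (c k * w k i j * \<bar>v i - v j\<bar>))"
      by (intro sum.cong refl) (simp add: ennreal_mult w c)
    also have "\<dots> = ennreal (\<Sum>i\<in>S. \<Sum>j\<in>S. c k * w k i j * \<bar>v i - v j\<bar>)"
      by (intro ennreal_sum2 mult_nonneg_nonneg) (auto intro: w c)
    also have "\<dots> \<le> ennreal (c k * d k)"
      using mult_left_mono[OF d[of k] c[of k]]
      by (intro ennreal_leI) (simp add: sum_distrib_left mult.assoc)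
    finally show ?thesis .
  qed
  have int_total: "(\<integral>\<^sup>+\<theta>. (\<Sum>k. D k \<theta>) \<partial>lborel) \<le> ennreal T"
  proof -
    have "(\<integral>\<^sup>+\<theta>. (\<Sum>k. D k \<theta>) \<partial>lborel) = (\<Sum>k. \<integral>\<^sup>+\<theta>. D k \<theta> \<partial>lborel)"
      by (intro nn_integral_suminf) simp
    also have "\<dots> \<le> ennreal T"
    proof (rule suminf_le_const)
      fix n
      have d0: "0 \<le> d k" for k
        by (rule order_trans[OF _ d]) (auto intro!: sum_nonneg mult_nonneg_nonneg w)
      have "(\<Sum>k<n. \<integral>\<^sup>+\<theta>. D k \<theta> \<partial>lborel) \<le> (\<Sum>k<n. ennreal (c k * d k))"
        by (intro sum_mono int_D)
      also have "\<dots> = ennreal (\<Sum>k<n. c k * d k)"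
        by (intro sum_ennreal) (simp add: c d0)
      also have "\<dots> \<le> ennreal T" by (intro ennreal_leI T)
      finally show "(\<Sum>k<n. \<integral>\<^sup>+\<theta>. D k \<theta> \<partial>lborel) \<le> ennreal T" .
    qed simp
    finally show ?thesis .
  qed
  have "\<exists>\<theta>\<in>{a..b}. \<forall>k. D k \<theta> \<le> ennreal (T' / (b - a))"
  proof (rule ccontr)
    assume "\<not> ?thesis"
    then have big: "\<exists>k. ennreal (T' / (b - a)) \<le> D k \<theta>" if "\<theta> \<in> {a..b}" for \<theta>
      using that by (meson linear)
    have "ennreal T' = ennreal (T' / (b - a)) * emeasure lborel {a..b}"
      using ab T0 T(2) by (simp flip: ennreal_mult)
    also have "\<dots> = (\<integral>\<^sup>+\<theta>. ennreal (T' / (b - a)) * indicator {a..b} \<theta> \<partial>lborel)"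
      by (simp add: nn_integral_cmult)
    also have "\<dots> \<le> (\<integral>\<^sup>+\<theta>. (\<Sum>k. D k \<theta>) \<partial>lborel)"
    proof (intro nn_integral_mono)
      fix \<theta>
      show "ennreal (T' / (b - a)) * indicator {a..b} \<theta> \<le> (\<Sum>k. D k \<theta>)"
      proof (cases "\<theta> \<in> {a..b}")
        case True
        then obtain k where "ennreal (T' / (b - a)) \<le> D k \<theta>" using big by blast
        also have "D k \<theta> = (\<Sum>k\<in>{k}. D k \<theta>)" by simp
        also have "\<dots> \<le> (\<Sum>k. D k \<theta>)" by (intro sum_le_suminf) auto
        finally show ?thesis using True by simp
      qed simp
    qed
    also have "\<dots> \<le> ennreal T" by (rule int_total)
    finally show False using T(2) T0 by (simp add: ennreal_le_iff)
  qed
  then obtain \<theta> where \<theta>: "a \<le> \<theta>" "\<theta> \<le> b" "\<And>k. D k \<theta> \<le> ennreal (T' / (b - a))"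
    by auto
  show ?thesis
  proof (rule that[OF \<theta>(1,2)])
    fix k
    have "0 \<le> T' / (b - a)" using ab T0 T(2) by simp
    then show "c k * (\<Sum>i\<in>S. \<Sum>j\<in>S. w k i j * of_bool ((\<theta> < v i) \<noteq> (\<theta> < v j))) \<le> T' / (b - a)"
      using \<theta>(3)[of k] unfolding D by (simp add: ennreal_le_iff)
  qed
qed

context reversible_generator
begin

text \<open>The inequality of the arithmetic and geometric means \<open>\<bar>x\<bar> \<le> x\<^sup>2 / (2 * e) + e / 2\<close> replaces the
  Cauchy--Schwarz inequality, so that no square roots appear.\<close>

lemma mean_abs_displacement_le:
  assumes nonneg: "\<And>i j. i \<in> S \<Longrightarrow> j \<in> S \<Longrightarrow> 0 \<le> P t i j" and e: "0 < e"
  shows "(\<Sum>i\<in>S. \<Sum>j\<in>S. p i * P t i j * \<bar>v i - v j\<bar>) \<le> displacement t v / (2 * e) + e / 2"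
proof -
  have pw: "\<bar>x\<bar> \<le> x\<^sup>2 / (2 * e) + e / 2" for x :: real
  proof -
    have "0 \<le> (\<bar>x\<bar> - e)\<^sup>2" by simp
    also have "\<dots> = x\<^sup>2 + e\<^sup>2 - 2 * e * \<bar>x\<bar>" by (simp add: power2_diff)
    finally show ?thesis using e by (simp add: field_simps power2_eq_square)
  qed
  have "(\<Sum>i\<in>S. \<Sum>j\<in>S. p i * P t i j * \<bar>v i - v j\<bar>)
      \<le> (\<Sum>i\<in>S. \<Sum>j\<in>S. p i * P t i j * ((v i - v j)\<^sup>2 / (2 * e) + e / 2))"
    by (intro sum_mono mult_left_mono pw mult_nonneg_nonneg weight_nonneg nonneg)
  also have "\<dots> = displacement t v / (2 * e) + (\<Sum>i\<in>S. p i * (\<Sum>j\<in>S. P t i j)) * (e / 2)"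
    unfolding displacement_def sum_divide_distrib sum_distrib_left sum_distrib_right
      sum.distrib[symmetric]
    by (intro sum.cong refl) (simp add: algebra_simps)
  also have "(\<Sum>i\<in>S. p i * (\<Sum>j\<in>S. P t i j)) = 1"
    by (simp add: transition_row_sum total)
  finally show ?thesis by simp
qed

text \<open>The function is the indicator of \<open>v > \<theta>\<close> for a spread eigenvector \<open>v\<close> of the spectral gap and
  \<open>\<bar>\<theta>\<bar> \<le> 1/16\<close>, which keeps the mass on both sides above \<open>1/256\<close>. At time \<open>(1/16)\<^sup>k\<close> in units of the relaxation
  time, \<open>v\<close> moves by about \<open>(1/4)\<^sup>k\<close>, and the weights \<open>2\<^sup>k\<close> in the choice of \<open>\<theta>\<close> leave the summable
  series of the \<open>(1/2)\<^sup>k\<close>.\<close>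

lemma exists_stable_boolean_function:
  assumes trans: "transitive_generator S Q"
    and nonneg: "\<And>t i j. 0 \<le> t \<Longrightarrow> i \<in> S \<Longrightarrow> j \<in> S \<Longrightarrow> 0 \<le> P t i j"
    and edge: "a \<in> S" "b \<in> S" "a \<noteq> b" "0 < Q a b"
  obtains f :: "'a \<Rightarrow> real" where "range f \<subseteq> {0, 1}"
    "1/256 \<le> (\<Sum>i\<in>S. p i * f i)" "(\<Sum>i\<in>S. p i * f i) \<le> 1 - 1/256"
    "\<And>k \<alpha>. 0 \<le> \<alpha> \<Longrightarrow> \<alpha> \<le> (1/16) ^ k \<Longrightarrow> displacement (\<alpha> * relaxation_time S Q) f \<le> 32 * (1/2) ^ k"
proof -
  define l where "l = spectral_gap S Q"
  define \<tau> where "\<tau> = relaxation_time S Q"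
  have l: "neg_generator_eigenvalue S Q l" "0 < l"
    using spectral_gap_eigenvalue[OF edge] by (auto simp: l_def)
  have \<tau>: "0 < \<tau>" "\<tau> * l = 1"
    using l(2) by (auto simp: \<tau>_def l_def relaxation_time_def)
  obtain v where v: "\<forall>i\<in>S. laplace v i = l * v i" "(\<Sum>i\<in>S. p i * v i) = 0"
    "(\<Sum>i\<in>S. p i * (v i)\<^sup>2) = 1" "1/4 \<le> (\<Sum>i\<in>S. p i * \<bar>v i\<bar>)"
    using exists_spread_eigenvector[OF trans l(1)] l(2) by auto
  have eig: "(\<Sum>j\<in>S. Q i j * v j) = - l * v i" if "i \<in> S" for i
  proof -
    have "- (\<Sum>j\<in>S. Q i j * v j) = l * v i"
      using v(1) that by (simp add: laplace_def sum_negf)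
    then show ?thesis by linarith
  qed
  define t where "t k = (1/16) ^ k * \<tau>" for k :: nat
  have t0: "0 \<le> t k" for k using \<tau> by (simp add: t_def)
  have disp_v: "displacement (t k) v \<le> 2 * (1/16) ^ k" for k
  proof -
    have "1 - exp (- ((1/16) ^ k)) \<le> ((1/16) ^ k :: real)"
      using exp_ge_add_one_self[of "- ((1/16::real) ^ k)"] by simp
    moreover have "t k * l = (1/16) ^ k" using \<tau>(2) by (simp add: t_def)
    ultimately show ?thesis
      using displacement_eigenvector[OF eig, of "t k"] v(3) by simp
  qed
  have moves: "(\<Sum>i\<in>S. \<Sum>j\<in>S. p i * P (t k) i j * \<bar>v i - v j\<bar>) \<le> 3/2 * (1/4) ^ k" for k
  proof -
    have "(\<Sum>i\<in>S. \<Sum>j\<in>S. p i * P (t k) i j * \<bar>v i - v j\<bar>) \<le>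
        displacement (t k) v / (2 * (1/4) ^ k) + (1/4) ^ k / 2"
      by (intro mean_abs_displacement_le nonneg t0) auto
    also have "displacement (t k) v / (2 * (1/4) ^ k) \<le> 2 * (1/16) ^ k / (2 * (1/4) ^ k)"
      by (intro divide_right_mono disp_v) simp
    also have "2 * (1/16) ^ k / (2 * (1/4) ^ k) = ((1/4) ^ k :: real)"
      by (simp add: power_divide[symmetric] flip: power_mult_distrib)
    finally show ?thesis by simp
  qed
  have weights: "(\<Sum>k<n. 2 ^ k * (3/2 * (1/4) ^ k)) \<le> (3::real)" for n
  proof -
    have "(2::real) ^ k * (3/2 * (1/4) ^ k) = 3/2 * (1/2) ^ k" for k
      by (simp flip: power_mult_distrib)
    then have "(\<Sum>k<n. 2 ^ k * (3/2 * (1/4) ^ k)) = 3/2 * (\<Sum>k<n. (1/2::real) ^ k)"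
      by (simp only: sum_distrib_left)
    also have "(\<Sum>k<n. (1/2::real) ^ k) = 2 - 2 * (1/2) ^ n"
      by (induction n) auto
    also have "3/2 * (2 - 2 * (1/2) ^ n) \<le> (3::real)" by simp
    finally show ?thesis .
  qed
  obtain \<theta> where \<theta>: "- 1/16 \<le> \<theta>" "\<theta> \<le> 1/16"
    "\<And>k. 2 ^ k * (\<Sum>i\<in>S. \<Sum>j\<in>S. p i * P (t k) i j * of_bool ((\<theta> < v i) \<noteq> (\<theta> < v j)))
      \<le> 4 / (1/16 - (- 1/16))"
    using exists_common_threshold[where a = "-1/16" and b = "1/16" and T = 3 and T' = 4
        and c = "\<lambda>k. 2 ^ k" and d = "\<lambda>k. 3/2 * (1/4) ^ k" and S = S and v = v
        and w = "\<lambda>k i j. p i * P (t k) i j", OF _ _ _ moves weights]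
    by (auto simp: weight_nonneg nonneg t0)
  define f where "f x = (of_bool (\<theta> < v x) :: real)" for x
  have mass: "(\<Sum>i\<in>{i\<in>S. \<theta> < v i}. p i) = (\<Sum>i\<in>S. p i * f i)"
    using finite_S by (intro sum.mono_neutral_cong_left) (auto simp: f_def)
  show ?thesis
  proof (rule that)
    show "range f \<subseteq> {0, 1}" by (auto simp: f_def)
    have "1/256 \<le> (\<Sum>i\<in>{i\<in>S. 1/16 < v i}. p i)"
      by (rule mass_above_of_positive_part[OF finite_S weight_nonneg total v(2,3,4)])
    also have "\<dots> \<le> (\<Sum>i\<in>{i\<in>S. \<theta> < v i}. p i)"
      using finite_S \<theta>(2) by (intro sum_mono2) (auto simp: weight_nonneg)
    finally show "1/256 \<le> (\<Sum>i\<in>S. p i * f i)" by (simp add: mass)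
    have "1/256 \<le> (\<Sum>i\<in>{i\<in>S. 1/16 < - v i}. p i)"
      by (rule mass_above_of_positive_part[OF finite_S weight_nonneg total])
        (use v(2-4) in \<open>auto simp: sum_negf\<close>)
    also have "\<dots> \<le> (\<Sum>i\<in>{i\<in>S. \<not> \<theta> < v i}. p i)"
      using finite_S \<theta>(1) by (intro sum_mono2) (auto simp: weight_nonneg)
    also have "\<dots> = (\<Sum>i\<in>S. p i * (1 - f i))"
      using finite_S by (intro sum.mono_neutral_cong_left) (auto simp: f_def)
    also have "\<dots> = 1 - (\<Sum>i\<in>S. p i * f i)"
      by (simp add: right_diff_distrib sum_subtractf total)
    finally show "(\<Sum>i\<in>S. p i * f i) \<le> 1 - 1/256" by simp
    fix k \<alpha> assume \<alpha>: "0 \<le> \<alpha>" "\<alpha> \<le> (1/16::real) ^ k"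
    \<comment> \<open>The threshold was chosen for the times \<open>t k\<close> only; monotonicity covers the times in between.\<close>
    have "displacement (\<alpha> * \<tau>) f \<le> displacement (t k) f"
      unfolding t_def using \<alpha> \<tau> by (intro displacement_mono nonneg mult_right_mono) auto
    also have "\<dots> = (\<Sum>i\<in>S. \<Sum>j\<in>S. p i * P (t k) i j * of_bool ((\<theta> < v i) \<noteq> (\<theta> < v j)))"
      unfolding displacement_def f_def by (intro sum.cong refl) auto
    also have "\<dots> \<le> 32 * (1/2) ^ k"
      using \<theta>(3)[of k] by (simp add: power_divide field_simps)
    finally show "displacement (\<alpha> * relaxation_time S Q) f \<le> 32 * (1/2) ^ k"
      by (simp add: \<tau>_def)
  qed
qed

end

section \<open>From the generator to the process\<close>

context ctmc
begin

lemma prob_pair: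
  assumes "0 \<le> t" "i \<in> S" "j \<in> S"
  shows "\<P>(\<omega> in M. X 0 \<omega> = i \<and> X t \<omega> = j) = pmf \<mu> i * transition_prob S Q t i j"
proof -
  have "\<P>(\<omega> in M. \<forall>k\<le>(1::nat). X (if k = 0 then 0 else t) \<omega> = (if k = 0 then i else j)) =
      pmf \<mu> i * transition_prob S Q t i j"
    using fdd[of "\<lambda>k. if k = 0 then 0 else t" 1 "\<lambda>k. if k = 0 then i else j"] assms by simp
  moreover have "(\<forall>k\<le>(1::nat). X (if k = 0 then 0 else t) \<omega> = (if k = 0 then i else j)) \<longleftrightarrow>
      X 0 \<omega> = i \<and> X t \<omega> = j" for \<omega>
    by (auto simp: le_Suc_eq)
  ultimately show ?thesis by simp
qed

text \<open>Nonnegativity of the matrix exponential is read off from the process: up to the factor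
  \<open>pmf \<mu> i\<close> its entries are probabilities.\<close>

lemma transition_nonneg:
  assumes "0 \<le> t" "i \<in> S" "j \<in> S" "0 < pmf \<mu> i"
  shows "0 \<le> transition_prob S Q t i j"
proof -
  have "0 \<le> pmf \<mu> i * transition_prob S Q t i j"
    by (simp flip: prob_pair[OF assms(1-3)])
  then show ?thesis using assms(4) by (simp add: zero_le_mult_iff)
qed

lemma prob_values_differ:
  assumes t: "0 \<le> t"
  shows "\<P>(\<omega> in M. f (X 0 \<omega>) \<noteq> f (X t \<omega>)) =
    (\<Sum>i\<in>S. \<Sum>j\<in>S. pmf \<mu> i * transition_prob S Q t i j * of_bool (f i \<noteq> f j))"
proof -
  define I where "I = {ij \<in> S \<times> S. f (fst ij) \<noteq> f (snd ij)}"
  define E where "E ij = {\<omega> \<in> space M. X 0 \<omega> = fst ij \<and> X t \<omega> = snd ij}" for ij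
  have XS: "X s \<omega> \<in> S" if "0 \<le> s" "\<omega> \<in> space M" for s \<omega>
    using measurable_space[OF rv[OF that(1)] that(2)] by simp
  have ev: "{\<omega> \<in> space M. X s \<omega> = i} \<in> events" if "0 \<le> s" "i \<in> S" for s i
  proof -
    have "X s -` {i} \<inter> space M \<in> events"
      using that by (intro measurable_sets[OF rv]) auto
    then show ?thesis by (simp add: vimage_def Int_def conj_commute)
  qed
  have E_ev: "E ij \<in> events" if "ij \<in> I" for ij
  proof -
    have "E ij = {\<omega> \<in> space M. X 0 \<omega> = fst ij} \<inter> {\<omega> \<in> space M. X t \<omega> = snd ij}"
      by (auto simp: E_def)
    then show ?thesis using that t by (auto simp: I_def intro!: ev)
  qed
  have fin: "finite I" using finite_states by (simp add: I_def)
  have "{\<omega> \<in> space M. f (X 0 \<omega>) \<noteq> f (X t \<omega>)} = (\<Union>ij\<in>I. E ij)"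
    using XS t by (auto simp: E_def I_def)
  moreover have "prob (\<Union>ij\<in>I. E ij) = (\<Sum>ij\<in>I. prob (E ij))"
    using E_ev by (intro finite_measure_finite_Union fin) (auto simp: disjoint_family_on_def E_def)
  ultimately have "\<P>(\<omega> in M. f (X 0 \<omega>) \<noteq> f (X t \<omega>)) = (\<Sum>ij\<in>I. prob (E ij))"
    by simp
  also have "\<dots> = (\<Sum>ij\<in>I. pmf \<mu> (fst ij) * transition_prob S Q t (fst ij) (snd ij))"
    unfolding E_def by (intro sum.cong refl prob_pair t) (auto simp: I_def)
  also have "\<dots> = (\<Sum>(i, j)\<in>S \<times> S. pmf \<mu> i * transition_prob S Q t i j * of_bool (f i \<noteq> f j))"
    using finite_states by (intro sum.mono_neutral_cong_left) (auto simp: I_def)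
  finally show ?thesis by (simp add: sum.cartesian_product)
qed

text \<open>Detailed balance carries positive mass along each edge of the chain.\<close>

lemma irreducible_reversible_pos:
  assumes rev: "reversible S Q \<mu>" and irr: "irreducible_generator S Q" and j: "j \<in> S"
  shows "0 < pmf \<mu> j"
proof -
  obtain i where i: "i \<in> set_pmf \<mu>" using set_pmf_not_empty[of \<mu>] by blast
  then have "i \<in> S" using initial by blast
  then have "(i, j) \<in> {(a, b). a \<in> S \<and> b \<in> S \<and> 0 < Q a b}\<^sup>*"
    using irr j by (simp add: irreducible_generator_def)
  then show ?thesis
  proof (induction rule: rtrancl_induct)
    case base
    then show ?case using i by (simp add: pmf_positive)
  next
    case (step a b)
    then have "0 < pmf \<mu> b * Q b a"
      using rev by (auto simp: reversible_def)
    then show ?case by (metis pmf_nonneg less_eq_real_def mult_zero_left order_less_irrefl)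
  qed
qed

text \<open>A path between two distinct states cannot consist of loops only.\<close>

lemma irreducible_edge:
  assumes irr: "irreducible_generator S Q" and card: "2 \<le> card S"
  obtains a b where "a \<in> S" "b \<in> S" "a \<noteq> b" "0 < Q a b"
proof -
  obtain x y where xy: "x \<in> S" "y \<in> S" "x \<noteq> y"
    using card by (metis card_2_iff' ex_card obtain_subset_with_card_n subset_iff)
  then have "(x, y) \<in> {(a, b). a \<in> S \<and> b \<in> S \<and> 0 < Q a b}\<^sup>*"
    using irr by (simp add: irreducible_generator_def)
  then have "x = y \<or> (\<exists>a b. a \<in> S \<and> b \<in> S \<and> a \<noteq> b \<and> 0 < Q a b)"
    by (induction rule: rtrancl_induct) auto
  then show ?thesis using xy(3) that by blast
qed

lemma boolean_variance_ge:
  fixes f :: "'a \<Rightarrow> real"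
  assumes f: "range f \<subseteq> {0, 1}" and c: "0 \<le> c"
    and m: "c \<le> (\<Sum>i\<in>S. pmf \<mu> i * f i)" "(\<Sum>i\<in>S. pmf \<mu> i * f i) \<le> 1 - c"
  shows "c\<^sup>2 \<le> measure_pmf.variance \<mu> f"
proof -
  define m where "m = (\<Sum>i\<in>S. pmf \<mu> i * f i)"
  have f2: "(f x)\<^sup>2 = f x" for x using f by (auto simp: image_subset_iff power2_eq_square)
  have E: "measure_pmf.expectation \<mu> g = (\<Sum>i\<in>S. pmf \<mu> i * g i)" for g :: "'a \<Rightarrow> real"
    using initial finite_states by (subst integral_measure_pmf_real[of S]) (auto simp: mult.commute)
  have tot: "(\<Sum>i\<in>S. pmf \<mu> i) = 1"
    using initial finite_states by (simp add: sum_pmf_eq_1)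
  have "measure_pmf.variance \<mu> f = (\<Sum>i\<in>S. pmf \<mu> i * (f i - m)\<^sup>2)"
    by (simp add: E m_def)
  also have "\<dots> = (\<Sum>i\<in>S. (1 - 2 * m) * (pmf \<mu> i * f i) + m\<^sup>2 * pmf \<mu> i)"
    by (intro sum.cong refl) (simp add: power2_diff f2 algebra_simps)
  also have "\<dots> = (1 - 2 * m) * m + m\<^sup>2"
    by (simp add: sum.distrib tot m_def flip: sum_distrib_left)
  also have "\<dots> = m * (1 - m)"
    by (simp add: power2_eq_square algebra_simps)
  finally show ?thesis
    using m c mult_mono[of c m c "1 - m"] by (simp add: m_def[symmetric] power2_eq_square)
qed

lemma exists_stable_function:
  assumes card: "2 \<le> card S" and trans: "transitive_generator S Q"
    and rev: "reversible S Q \<mu>" and irr: "irreducible_generator S Q"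
  obtains f :: "'a \<Rightarrow> real" where "range f \<subseteq> {0, 1}" "(1/256)\<^sup>2 \<le> measure_pmf.variance \<mu> f"
    "\<And>k \<alpha>. 0 \<le> \<alpha> \<Longrightarrow> \<alpha> \<le> (1/16) ^ k \<Longrightarrow>
      \<P>(\<omega> in M. f (X 0 \<omega>) \<noteq> f (X (\<alpha> * relaxation_time S Q) \<omega>)) \<le> 32 * (1/2) ^ k"
proof -
  interpret reversible_generator S Q "pmf \<mu>"
    using finite_states generator initial irreducible_reversible_pos[OF rev irr] rev
    by unfold_locales (auto simp: sum_pmf_eq_1 reversible_def)
  have nonneg: "0 \<le> transition_prob S Q t i j" if "0 \<le> t" "i \<in> S" "j \<in> S" for t i j
    using that pos by (intro transition_nonneg)
  obtain a b where edge: "a \<in> S" "b \<in> S" "a \<noteq> b" "0 < Q a b"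
    using irreducible_edge[OF irr card] .
  obtain f :: "'a \<Rightarrow> real" where f: "range f \<subseteq> {0, 1}"
    "1/256 \<le> (\<Sum>i\<in>S. pmf \<mu> i * f i)" "(\<Sum>i\<in>S. pmf \<mu> i * f i) \<le> 1 - 1/256"
    "\<And>k \<alpha>. 0 \<le> \<alpha> \<Longrightarrow> \<alpha> \<le> (1/16) ^ k \<Longrightarrow> displacement (\<alpha> * relaxation_time S Q) f \<le> 32 * (1/2) ^ k"
    using exists_stable_boolean_function[OF trans nonneg edge] by blast
  have \<tau>: "0 \<le> relaxation_time S Q"
    using spectral_gap_eigenvalue(2)[OF edge] by (simp add: relaxation_time_def)
  show ?thesis
  proof (rule that[OF f(1)])
    show "(1/256)\<^sup>2 \<le> measure_pmf.variance \<mu> f"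
      by (rule boolean_variance_ge[OF f(1) _ f(2,3)]) simp
    fix k \<alpha> assume \<alpha>: "0 \<le> \<alpha>" "\<alpha> \<le> (1/16::real) ^ k"
    have sq: "of_bool (f i \<noteq> f j) = (f i - f j)\<^sup>2" for i j
    proof -
      have "f i \<in> {0, 1}" "f j \<in> {0, 1}" using f(1) by auto
      then show ?thesis by auto
    qed
    have "\<P>(\<omega> in M. f (X 0 \<omega>) \<noteq> f (X (\<alpha> * relaxation_time S Q) \<omega>)) =
        displacement (\<alpha> * relaxation_time S Q) f"
      using \<alpha> \<tau> by (simp add: prob_values_differ displacement_def sq)
    also have "\<dots> \<le> 32 * (1/2) ^ k" by (rule f(4)[OF \<alpha>])
    finally show "\<P>(\<omega> in M. f (X 0 \<omega>) \<noteq> f (X (\<alpha> * relaxation_time S Q) \<omega>)) \<le> 32 * (1/2) ^ k" .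
  qed
qed

end

theorem proposition3p2:
  fixes M :: "nat \<Rightarrow> 'b measure"
    and S :: "nat \<Rightarrow> 'a set"
    and Q :: "nat \<Rightarrow> 'a \<Rightarrow> 'a \<Rightarrow> real"
    and \<pi> :: "nat \<Rightarrow> 'a pmf"
    and X :: "nat \<Rightarrow> real \<Rightarrow> 'b \<Rightarrow> 'a"
  assumes "\<And>n. ctmc (M n) (S n) (Q n) (\<pi> n) (X n)"
    and "\<And>n. card (S n) \<ge> 2"
    and "\<And>n. stationary (S n) (Q n) (\<pi> n)"
    and "\<And>n. transitive_generator (S n) (Q n)"
    and "\<And>n. reversible (S n) (Q n) (\<pi> n)"
    and "\<And>n. irreducible_generator (S n) (Q n)"
  shows "\<exists>f :: nat \<Rightarrow> 'a \<Rightarrow> real. (\<forall>n. f n \<in> S n \<rightarrow> {0, 1}) \<and>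
           nondegenerate \<pi> f \<and> noise_stable M S Q X f"
proof -
  let ?stable = "\<lambda>n f. range f \<subseteq> {0, 1} \<and> (1/256)\<^sup>2 \<le> measure_pmf.variance (\<pi> n) f \<and>
    (\<forall>k \<alpha>. 0 \<le> \<alpha> \<longrightarrow> \<alpha> \<le> (1/16) ^ k \<longrightarrow>
      \<P>(\<omega> in M n. f (X n 0 \<omega>) \<noteq> f (X n (\<alpha> * relaxation_time (S n) (Q n)) \<omega>)) \<le> 32 * (1/2) ^ k)"
  have "\<forall>n. \<exists>f :: 'a \<Rightarrow> real. ?stable n f"
  proof
    fix n
    show "\<exists>f :: 'a \<Rightarrow> real. ?stable n f"
      by (rule ctmc.exists_stable_function[OF assms(1,2,4,5,6)[of n]]) (intro exI conjI allI impI)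
  qed
  from choice[OF this] obtain f :: "nat \<Rightarrow> 'a \<Rightarrow> real" where f: "\<And>n. ?stable n (f n)"
    by blast
  let ?noise = "\<lambda>n \<alpha>. \<P>(\<omega> in M n. f n (X n 0 \<omega>) \<noteq> f n (X n (\<alpha> * relaxation_time (S n) (Q n)) \<omega>))"
  have "nondegenerate \<pi> f"
  proof -
    have "ereal ((1/256)\<^sup>2) \<le> liminf (\<lambda>n. ereal (measure_pmf.variance (\<pi> n) (f n)))"
      by (intro Liminf_bounded always_eventually allI) (use f in simp)
    moreover have "0 < ereal ((1/256)\<^sup>2)" by simp
    ultimately show ?thesis
      unfolding nondegenerate_def by (rule less_le_trans[rotated])
  qed
  moreover have "noise_stable M S Q X f"
  proof -
    have prob: "prob_space (M n)" for n
      using assms(1)[of n] by (simp add: ctmc_def)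
    have bdd: "bdd_above (range (\<lambda>n. ?noise n \<alpha>))" for \<alpha>
      by (intro bdd_aboveI2[of _ _ 1]) (rule prob_space.prob_le_1[OF prob])
    have lower: "0 \<le> (SUP n. ?noise n \<alpha>)" for \<alpha>
      by (rule cSUP_upper2[OF bdd, of 0]) auto
    have upper: "(SUP n. ?noise n \<alpha>) \<le> 32 * (1/2) ^ k" if "0 \<le> \<alpha>" "\<alpha> \<le> (1/16) ^ k" for \<alpha> k
      by (intro cSUP_least) (use f that in auto)
    show ?thesis
      unfolding noise_stable_def
    proof (rule tendstoI)
      fix e :: real assume "0 < e"
      then obtain k where k: "(1/2) ^ k < e / 32"
        using real_arch_pow_inv[of "e / 32" "1/2"] by auto
      have "eventually (\<lambda>\<alpha>. \<alpha> \<in> {0<..<(1/16) ^ k}) (at_right (0::real))"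
        by (rule eventually_at_right_real) simp
      then show "eventually (\<lambda>\<alpha>. dist (SUP n. ?noise n \<alpha>) 0 < e) (at_right 0)"
      proof (rule eventually_mono)
        fix \<alpha> :: real assume "\<alpha> \<in> {0<..<(1/16) ^ k}"
        then have "(SUP n. ?noise n \<alpha>) \<le> 32 * (1/2) ^ k" by (intro upper) auto
        then show "dist (SUP n. ?noise n \<alpha>) 0 < e" using k lower[of \<alpha>] by (simp add: dist_real_def)
      qed
    qed
  qed
  moreover have "f n \<in> S n \<rightarrow> {0, 1}" for n
    using f[of n] by auto
  ultimately show ?thesis by blast
qed

end
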